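(* Let $\Omega\subseteq\mathbb{R}^n$ be an open set, let $1\le p<\infty$, and let $w$ be a weight on $\Omega$. If $w$ is bounded and the embedding $W^{1,p}(\Omega,w)\to L^p(\Omega,w)$ is compact, then necessarily $$\int_\Omega w(x)\,dx<+\infty.$$
   Context: A weight on an open set $\Omega\subseteq\mathbb{R}^n$ is a real-valued measurable function $w$ on $\Omega$ that is a.e. positive and finite. Standing assumption on $w$: if $p>1$, then $w^{-1/(p-1)}\in L^1_{\mathrm{loc}}(\Omega)$; if $p=1$, then $\operatorname{ess\,sup}_{x\in B}\frac1{w(x)}<+\infty$ for every ball $B\subset\Omega$. (Under this assumption $L^p(\Omega,w)\subseteq L^1_{\mathrm{loc}}(\Omega)$.) $L^p(\Omega,w)$ is the space of measurable $u$ with $\|u\|_{L^p(\Omega,w)}=\left(\int_\Omega |u(x)|^p w(x)\,dx\right)^{1/p}<+\infty$. $W^{1,p}(\Omega,w)$ is the space of $u\in L^p(\Omega,w)$ whose first-order distributional derivatives belong to $L^p(\Omega,w)$, with norm $\left(\int_\Omega |u|^p w\,dx+\int_\Omega|\nabla u|^p w\,dx\right)^{1/p}$. *)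

theory Defs
  imports "HOL-Analysis.Analysis" "HOL-Probability.Essential_Supremum"
begin

section \<open>Weights\<close>

definition locally_integrable_on ::
    "('a::euclidean_space \<Rightarrow> 'b::euclidean_space) \<Rightarrow> 'a set \<Rightarrow> bool"
    (infixr \<open>locally'_integrable'_on\<close> 46)
  where "f locally_integrable_on \<Omega> \<longleftrightarrow>
    (\<forall>K. compact K \<and> K \<subseteq> \<Omega> \<longrightarrow> f absolutely_integrable_on K)"

definition weight_on :: "'a::euclidean_space set \<Rightarrow> ('a \<Rightarrow> real) \<Rightarrow> bool"
  where "weight_on \<Omega> w \<longleftrightarrow>
    w \<in> borel_measurable (lebesgue_on \<Omega>) \<and> (AE x in lebesgue_on \<Omega>. 0 < w x)"

text \<open>The standing assumption on weights. The balls are the open balls contained in \<open>\<Omega>\<close>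
  (they may touch the boundary of \<open>\<Omega>\<close>). Values of \<open>w\<close> that are not positive
  only occur on a null set, so the values of \<open>1 / w x\<close> and \<open>powr\<close> there are irrelevant.\<close>

definition weight_condition :: "'a::euclidean_space set \<Rightarrow> real \<Rightarrow> ('a \<Rightarrow> real) \<Rightarrow> bool"
  where "weight_condition \<Omega> p w \<longleftrightarrow>
    (p > 1 \<longrightarrow> (\<lambda>x. w x powr (- 1 / (p - 1))) locally_integrable_on \<Omega>) \<and>
    (p = 1 \<longrightarrow> (\<forall>x r. 0 < r \<and> ball x r \<subseteq> \<Omega> \<longrightarrow>
        esssup (lebesgue_on (ball x r)) (\<lambda>y. ereal (1 / w y)) < \<infinity>))"

section \<open>Weighted Lebesgue spaces\<close>

text \<open>Function spaces are sets of functions, not of equivalence classes modulo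
  a.e. equality; the corresponding norms are thus seminorms on functions. Only the values of
  a function on \<open>\<Omega>\<close> matter.\<close>

definition weighted_Lp :: "'a::euclidean_space set \<Rightarrow> real \<Rightarrow> ('a \<Rightarrow> real) \<Rightarrow> ('a \<Rightarrow> real) set"
  where "weighted_Lp \<Omega> p w =
    {u. u \<in> borel_measurable (lebesgue_on \<Omega>) \<and>
        (\<integral>\<^sup>+x. ennreal (\<bar>u x\<bar> powr p * w x) \<partial>lebesgue_on \<Omega>) < \<infinity>}"

definition weighted_Lp_norm ::
    "'a::euclidean_space set \<Rightarrow> real \<Rightarrow> ('a \<Rightarrow> real) \<Rightarrow> ('a \<Rightarrow> real) \<Rightarrow> real"
  where "weighted_Lp_norm \<Omega> p w u =
    (LINT x|lebesgue_on \<Omega>. \<bar>u x\<bar> powr p * w x) powr (1 / p)"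

section \<open>Distributional derivatives\<close>

text \<open>\<open>C_diff k f\<close>: \<open>f\<close> is of class \<open>C\<^sup>k\<close> on the whole space. At stage \<open>Suc k\<close>, the function
  is differentiable and all its first-order partial derivatives are of class \<open>C\<^sup>k\<close>.\<close>

primrec C_diff :: "nat \<Rightarrow> ('a::euclidean_space \<Rightarrow> real) \<Rightarrow> bool"
  where
    "C_diff 0 f \<longleftrightarrow> continuous_on UNIV f"
  | "C_diff (Suc k) f \<longleftrightarrow> f differentiable_on UNIV \<and>
       (\<forall>b\<in>Basis. C_diff k (\<lambda>x. frechet_derivative f (at x) b))"

text \<open>\<open>C\<^sub>c\<^sup>\<infinity>(\<Omega>)\<close>, each function being extended by zero outside \<open>\<Omega>\<close>.\<close>

definition test_functions :: "'a::euclidean_space set \<Rightarrow> ('a \<Rightarrow> real) set"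
  where "test_functions \<Omega> =
    {\<phi>. (\<forall>k. C_diff k \<phi>) \<and> compact (closure {x. \<phi> x \<noteq> 0}) \<and> closure {x. \<phi> x \<noteq> 0} \<subseteq> \<Omega>}"

text \<open>\<open>G\<close> is the distributional gradient of \<open>u\<close>: for each coordinate direction \<open>b\<close>, the
  distribution \<open>\<partial>\<^sub>b u\<close> is represented by the locally integrable function \<open>\<lambda>x. G x \<bullet> b\<close>.
  Local integrability is demanded explicitly, because the Bochner integral of a
  non-integrable function is \<open>0\<close>.\<close>

definition has_weak_gradient ::
    "'a::euclidean_space set \<Rightarrow> ('a \<Rightarrow> real) \<Rightarrow> ('a \<Rightarrow> 'a) \<Rightarrow> bool"
  where "has_weak_gradient \<Omega> u G \<longleftrightarrow>
    u locally_integrable_on \<Omega> \<and> G locally_integrable_on \<Omega> \<and>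
    (\<forall>\<phi>\<in>test_functions \<Omega>. \<forall>b\<in>Basis.
       (LINT x|lebesgue_on \<Omega>. u x * frechet_derivative \<phi> (at x) b) =
       - (LINT x|lebesgue_on \<Omega>. (G x \<bullet> b) * \<phi> x))"

text \<open>The choice only affects values on a null set of \<open>\<Omega>\<close> (and values outside \<open>\<Omega>\<close>).\<close>

definition weak_gradient ::
    "'a::euclidean_space set \<Rightarrow> ('a \<Rightarrow> real) \<Rightarrow> 'a \<Rightarrow> 'a"
  where "weak_gradient \<Omega> u = (SOME G. has_weak_gradient \<Omega> u G)"

section \<open>Weighted Sobolev spaces and compact embeddings\<close>

definition weighted_W1p :: "'a::euclidean_space set \<Rightarrow> real \<Rightarrow> ('a \<Rightarrow> real) \<Rightarrow> ('a \<Rightarrow> real) set"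
  where "weighted_W1p \<Omega> p w =
    {u \<in> weighted_Lp \<Omega> p w.
       \<exists>G. has_weak_gradient \<Omega> u G \<and> (\<forall>b\<in>Basis. (\<lambda>x. G x \<bullet> b) \<in> weighted_Lp \<Omega> p w)}"

definition weighted_W1p_norm ::
    "'a::euclidean_space set \<Rightarrow> real \<Rightarrow> ('a \<Rightarrow> real) \<Rightarrow> ('a \<Rightarrow> real) \<Rightarrow> real"
  where "weighted_W1p_norm \<Omega> p w u =
    ((LINT x|lebesgue_on \<Omega>. \<bar>u x\<bar> powr p * w x) +
     (LINT x|lebesgue_on \<Omega>. norm (weak_gradient \<Omega> u x) powr p * w x)) powr (1 / p)"

text \<open>Compactness of the inclusion of the (semi)normed function space \<open>(X, N)\<close> into
  \<open>(Y, M)\<close>: every sequence bounded in \<open>X\<close> has a subsequence converging in \<open>Y\<close>.\<close>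

definition compact_embedding ::
    "('a \<Rightarrow> real) set \<Rightarrow> (('a \<Rightarrow> real) \<Rightarrow> real) \<Rightarrow>
     ('a \<Rightarrow> real) set \<Rightarrow> (('a \<Rightarrow> real) \<Rightarrow> real) \<Rightarrow> bool"
  where "compact_embedding X N Y M \<longleftrightarrow> X \<subseteq> Y \<and>
    (\<forall>u :: nat \<Rightarrow> 'a \<Rightarrow> real. range u \<subseteq> X \<and> bounded (range (\<lambda>k. N (u k))) \<longrightarrow>
       (\<exists>v\<in>Y. \<exists>r :: nat \<Rightarrow> nat. strict_mono r \<and>
          (\<lambda>k. M (\<lambda>x. u (r k) x - v x)) \<longlonglongrightarrow> 0))"

end

theory Submission
  imports Defs
begin

text \<open>
  Write \<open>\<rho> x = sqrt (1 + |x|\<^sup>2)\<close> and \<open>m k = \<integral> w\<close> over \<open>\<Omega> \<inter> {\<rho> < k}\<close>, and suppose that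
  \<open>\<integral> w = \<infinity>\<close>, so that \<open>m\<close> is unbounded. Since \<open>w\<close> is bounded, \<open>m k\<close> grows at most like
  \<open>k ^ n\<close>, where \<open>n\<close> is the dimension, and the mass of an annulus \<open>i + 1 \<le> \<rho> < j\<close> cannot more
  than double at every step from \<open>j\<close> to \<open>j + 1\<close>. Hence for each \<open>i\<close> there is
  some \<open>j > i\<close> for which the two unit layers \<open>i \<le> \<rho> < i + 1\<close> and \<open>j \<le> \<rho> < j + 1\<close>
  both have mass at most the mass \<open>s > 0\<close> of the annulus \<open>i + 1 \<le> \<rho> < j\<close> between them
  (\<open>light_boundary_layers\<close>).

  Take a \<open>C\<^sup>1\<close> radial cutoff that is \<open>1\<close> on the annulus and \<open>0\<close> outside the annulus and the
  layers, so that its gradient is bounded and lives on the layers only, and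
  multiply it by \<open>s powr (- 1 / p)\<close>.
  This gives a function \<open>u i\<close> with \<open>\<integral> |u i| powr p w \<ge> 1\<close> whose Sobolev norm is bounded
  independently of \<open>i\<close> (\<open>normalized_annular_function\<close>). The supports move off to infinity, so
  for any \<open>a\<close> the functions \<open>u a\<close> and \<open>u b\<close> have disjoint supports once \<open>b\<close> is large. Then
  \<open>u a - u b\<close> is at least as large as \<open>u a\<close> in \<open>L\<^sup>p\<close>, so no subsequence converges
  (\<open>escaping_functions_contradict_compactness\<close>), contradicting compactness.

  The Sobolev norm is defined through an arbitrarily chosen weak gradient. To evaluate it on a
  \<open>C\<^sup>1\<close> function one needs that the classical gradient is a weak gradient
  (\<open>C1_has_weak_gradient\<close>) and that weak gradients agree almost everywhere
  (\<open>weak_gradient_unique\<close>). The latter is the fundamental lemma of the calculus of variations,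
  for which smooth bump functions approximating indicators of boxes are constructed first.
\<close>

section \<open>Smooth bump functions\<close>

text \<open>Lets a derivative that has been computed take the place of the choice operator
  \<open>frechet_derivative\<close> in the stagewise definition.\<close>

lemma C_diff_SucI:
  assumes "\<And>x. (f has_derivative D x) (at x)"
    and "\<And>b. b \<in> Basis \<Longrightarrow> C_diff k (\<lambda>x. D x b)"
  shows "C_diff (Suc k) f"
proof -
  have "frechet_derivative f (at x) = D x" for x
    using assms(1) frechet_derivative_at by metis
  then show ?thesis
    using assms by (auto simp: differentiable_on_def differentiable_def)
qed

lemma C_diff_SucD:
  assumes "C_diff (Suc k) f"
  shows "(f has_derivative frechet_derivative f (at x)) (at x)"
    and "b \<in> Basis \<Longrightarrow> C_diff k (\<lambda>x. frechet_derivative f (at x) b)"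
  using assms by (auto simp: differentiable_on_def frechet_derivative_works)

lemma C_diff_Suc_imp: "C_diff (Suc k) f \<Longrightarrow> C_diff k f"
proof (induction k arbitrary: f)
  case 0
  then show ?case
    by (auto intro: differentiable_imp_continuous_on)
next
  case (Suc k)
  then show ?case
    by (metis C_diff.simps(2))
qed

lemma C_diff_imp_continuous: "C_diff k f \<Longrightarrow> continuous_on UNIV f"
  by (induction k) (auto intro: differentiable_imp_continuous_on)

lemma C_diff_const: "C_diff k (\<lambda>x. c)"
  by (induction k arbitrary: c) (auto intro!: C_diff_SucI derivative_eq_intros simp del: C_diff.simps(2))

lemma C_diff_add: "C_diff k f \<Longrightarrow> C_diff k g \<Longrightarrow> C_diff k (\<lambda>x. f x + g x)"
proof (induction k arbitrary: f g)
  case 0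
  then show ?case by (auto intro: continuous_intros)
next
  case (Suc k)
  show ?case
    by (rule C_diff_SucI[OF has_derivative_add[OF Suc.prems[THEN C_diff_SucD(1)]]])
      (intro Suc.IH Suc.prems[THEN C_diff_SucD(2)])
qed

lemma C_diff_mult: "C_diff k f \<Longrightarrow> C_diff k g \<Longrightarrow> C_diff k (\<lambda>x. f x * g x)"
proof (induction k arbitrary: f g)
  case 0
  then show ?case by (auto intro: continuous_intros)
next
  case (Suc k)
  show ?case
    by (rule C_diff_SucI[OF has_derivative_mult[OF Suc.prems[THEN C_diff_SucD(1)]]])
      (intro C_diff_add Suc.IH Suc.prems[THEN C_diff_SucD(2)] Suc.prems[THEN C_diff_Suc_imp])
qed

lemma C_diff_prod: "(\<And>i. i \<in> I \<Longrightarrow> C_diff k (f i)) \<Longrightarrow> C_diff k (\<lambda>x. \<Prod>i\<in>I. f i x)"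
  by (induction I rule: infinite_finite_induct) (auto intro: C_diff_const C_diff_mult)

text \<open>The functions \<open>exp (- 1 / t) / t ^ m\<close>, extended by zero to \<open>t \<le> 0\<close>. The case \<open>m = 0\<close> is
  the standard flat function; all powers are treated together because the derivative of a member
  of the family is a linear combination of members, so that smoothness follows by induction.\<close>

definition flat_exp :: "nat \<Rightarrow> real \<Rightarrow> real"
  where "flat_exp m t = (if t \<le> 0 then 0 else exp (- 1 / t) / t ^ m)"

lemma flat_exp_tendsto_0: "(flat_exp m \<longlongrightarrow> 0) (at 0)"
proof -
  have "((\<lambda>t::real. inverse t ^ m / exp (inverse t)) \<longlongrightarrow> 0) (at_right 0)"
    using filterlim_compose[OF tendsto_power_div_exp_0 filterlim_inverse_at_top_right] .
  then have "(flat_exp m \<longlongrightarrow> 0) (at_right 0)"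
    by (rule Lim_transform_eventually)
      (auto intro!: eventually_at_rightI[of 0 1] simp: flat_exp_def exp_minus field_simps)
  moreover have "(flat_exp m \<longlongrightarrow> 0) (at_left 0)"
    by (rule tendsto_eventually)
      (auto intro!: eventually_at_leftI[of "-1"] simp: flat_exp_def)
  ultimately show ?thesis
    by (simp add: filterlim_at_split)
qed

text \<open>At the origin the difference quotient of \<open>flat_exp m\<close> is \<open>flat_exp (m + 1)\<close>, which tends
  to zero like every member of the family.\<close>

lemma DERIV_flat_exp:
  "(flat_exp m has_real_derivative flat_exp (m + 2) t - real m * flat_exp (m + 1) t) (at t)"
proof (cases t "0 :: real" rule: linorder_cases)
  case less
  have "((\<lambda>t. 0) has_real_derivative flat_exp (m + 2) t - real m * flat_exp (m + 1) t) (at t)"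
    using less by (simp add: flat_exp_def)
  then show ?thesis
    by (rule has_field_derivative_transform_within_open[where S = "{..<0}"])
      (use less in \<open>auto simp: flat_exp_def\<close>)
next
  case equal
  have "(flat_exp m has_real_derivative 0) (at 0)"
    unfolding has_field_derivative_iff
    by (rule Lim_transform_eventually[OF flat_exp_tendsto_0[of "Suc m"]])
      (auto simp: flat_exp_def eventually_at_filter)
  then show ?thesis
    using equal by (simp add: flat_exp_def)
next
  case greater
  have [derivative_intros]: "((\<lambda>t. t ^ m) has_real_derivative real m * t ^ m / t) (at t)"
    using greater by (intro DERIV_cong[OF DERIV_pow]) (cases m; simp)
  have "((\<lambda>t. exp (- 1 / t) / t ^ m) has_real_derivative
      exp (- 1 / t) / t ^ (m + 2) - real m * (exp (- 1 / t) / t ^ (m + 1))) (at t)"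
    using greater
    by (auto intro!: derivative_eq_intros simp: divide_simps power2_eq_square algebra_simps)
  then have "((\<lambda>t. exp (- 1 / t) / t ^ m) has_real_derivative
      flat_exp (m + 2) t - real m * flat_exp (m + 1) t) (at t)"
    using greater by (simp add: flat_exp_def)
  then show ?thesis
    by (rule has_field_derivative_transform_within_open[where S = "{0<..}"])
      (use greater in \<open>auto simp: flat_exp_def\<close>)
qed

lemma C_diff_flat_exp_affine: "C_diff k (\<lambda>x. flat_exp m (x \<bullet> v + d))"
proof (induction k arbitrary: m)
  case 0
  have "continuous_on UNIV (flat_exp m)"
    using DERIV_flat_exp DERIV_isCont by (metis continuous_at_imp_continuous_on)
  then show ?case
    by (auto intro!: continuous_on_compose2[where g = "flat_exp m" and t = UNIV] continuous_intros)
next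
  case (Suc k)
  have D: "((\<lambda>x. flat_exp m (x \<bullet> v + d)) has_derivative
      (\<lambda>h. (h \<bullet> v) * (flat_exp (m + 2) (x \<bullet> v + d) + (- real m) * flat_exp (m + 1) (x \<bullet> v + d)))) (at x)" for x
    by (rule has_derivative_eq_rhs[OF DERIV_compose_FDERIV[OF DERIV_flat_exp]])
      (auto intro!: derivative_eq_intros simp: fun_eq_iff)
  show ?case
    by (rule C_diff_SucI[OF D]) (intro C_diff_mult C_diff_add C_diff_const Suc)
qed

text \<open>Since \<open>flat_exp 0 (c * s)\<close> tends to \<open>1\<close> for every \<open>s > 0\<close> as \<open>c\<close> grows, these products
  of one-dimensional bumps converge to the indicator of the open box without any normalization.\<close>

definition box_bump :: "real \<Rightarrow> 'a::euclidean_space \<Rightarrow> 'a \<Rightarrow> 'a \<Rightarrow> real"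
  where "box_bump c a b x =
    (\<Prod>i\<in>Basis. flat_exp 0 (c * (x \<bullet> i - a \<bullet> i)) * flat_exp 0 (c * (b \<bullet> i - x \<bullet> i)))"

lemma flat_exp_0: "0 \<le> flat_exp 0 t" "flat_exp 0 t \<le> 1" "flat_exp 0 t \<noteq> 0 \<longleftrightarrow> 0 < t"
  by (auto simp: flat_exp_def)

lemma box_bump_bounds: "\<bar>box_bump c a b x\<bar> \<le> 1"
  unfolding box_bump_def abs_prod
  by (intro prod_le_1) (auto simp: flat_exp_0 mult_le_one)

lemma box_bump_eq_0:
  assumes "0 < c" "x \<notin> box a b"
  shows "box_bump c a b x = 0"
proof -
  obtain i where i: "i \<in> Basis" "x \<bullet> i - a \<bullet> i \<le> 0 \<or> b \<bullet> i - x \<bullet> i \<le> 0"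
    using assms(2) by (auto simp: mem_box not_less)
  then have "flat_exp 0 (c * (x \<bullet> i - a \<bullet> i)) * flat_exp 0 (c * (b \<bullet> i - x \<bullet> i)) = 0"
    using assms(1) by (auto simp: flat_exp_def mult_nonneg_nonpos)
  then show ?thesis
    unfolding box_bump_def using i(1) by (intro prod_zero) auto
qed

lemma C_diff_box_bump: "C_diff k (box_bump c a b)"
proof -
  have "C_diff k (\<lambda>x. \<Prod>i\<in>Basis. flat_exp 0 (x \<bullet> (c *\<^sub>R i) + (- (c * (a \<bullet> i)))) *
      flat_exp 0 (x \<bullet> (- c *\<^sub>R i) + c * (b \<bullet> i)))"
    by (intro C_diff_prod C_diff_mult C_diff_flat_exp_affine)
  then show ?thesis
    by (rule arg_cong[where f = "C_diff k", THEN iffD1, rotated])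
      (auto simp: fun_eq_iff box_bump_def algebra_simps)
qed

lemma box_bump_test_function:
  assumes "0 < c" "cbox a b \<subseteq> \<Omega>"
  shows "box_bump c a b \<in> test_functions \<Omega>"
proof -
  have "{x. box_bump c a b x \<noteq> 0} \<subseteq> cbox a b"
    using box_bump_eq_0[OF assms(1)] box_subset_cbox by blast
  then have "closure {x. box_bump c a b x \<noteq> 0} \<subseteq> cbox a b"
    by (rule closure_minimal) (rule closed_cbox)
  then show ?thesis
    using assms(2) C_diff_box_bump
    by (auto simp: test_functions_def compact_eq_bounded_closed intro: bounded_subset[OF bounded_cbox])
qed

lemma box_bump_tendsto:
  fixes x :: "'a::euclidean_space"
  shows "(\<lambda>n. box_bump (real (Suc n)) a b x) \<longlonglongrightarrow> indicator (box a b) x"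
proof (cases "x \<in> box a b")
  case False
  then show ?thesis
    by (simp add: box_bump_eq_0)
next
  case True
  have lim: "(\<lambda>n. flat_exp 0 (real (Suc n) * s)) \<longlonglongrightarrow> 1" if "0 < s" for s
  proof -
    have "(\<lambda>n. exp (- (inverse (real (Suc n)) * (1 / s)))) \<longlonglongrightarrow> exp (- (0 * (1 / s)))"
      by (intro tendsto_intros LIMSEQ_inverse_real_of_nat)
    then show ?thesis
      by (rule Lim_transform_eventually[OF _ always_eventually, THEN tendsto_eq_rhs])
        (use that in \<open>auto simp: flat_exp_def not_le field_simps add_pos_nonneg\<close>)
  qed
  have "(\<lambda>n. box_bump (real (Suc n)) a b x) \<longlonglongrightarrow> (\<Prod>i\<in>(Basis :: 'a set). 1 * 1)"
    unfolding box_bump_def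
    by (intro tendsto_prod tendsto_mult lim) (use True in \<open>auto simp: mem_box\<close>)
  then show ?thesis
    using True by simp
qed

section \<open>Integration by parts\<close>

lemma continuous_compact_support_integrable:
  fixes f :: "'a::euclidean_space \<Rightarrow> real"
  assumes "continuous_on UNIV f" "\<And>x. x \<notin> K \<Longrightarrow> f x = 0" "compact K"
  shows "integrable lborel f"
proof -
  have "integrable lborel (\<lambda>x. indicator K x *\<^sub>R f x)"
    by (intro borel_integrable_compact assms continuous_on_subset[OF assms(1)]) auto
  moreover have "(\<lambda>x. indicator K x *\<^sub>R f x) = f"
    using assms(2) by (auto simp: indicator_def fun_eq_iff)
  ultimately show ?thesis by simp
qed

lemma has_derivative_eq_0_outside:
  fixes f :: "'a::real_normed_vector \<Rightarrow> real"
  assumes "(f has_derivative D) (at x)" "closed K" "\<And>x. x \<notin> K \<Longrightarrow> f x = 0" "x \<notin> K"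
  shows "D = (\<lambda>_. 0)"
proof -
  have "((\<lambda>_. 0) has_derivative D) (at x)"
    by (rule has_derivative_transform_within_open[OF assms(1), of "- K"]) (use assms in auto)
  then show ?thesis
    by (metis has_derivative_const has_derivative_unique)
qed

text \<open>By translation invariance of Lebesgue measure all difference quotients in the direction
  \<open>b\<close> have integral zero. They are uniformly bounded by the mean value theorem and vanish outside a
  fixed ball, so dominated convergence passes to the derivative.\<close>

lemma integral_directional_derivative_eq_0:
  fixes f :: "'a::euclidean_space \<Rightarrow> real"
  assumes D: "\<And>x. (f has_derivative f' x) (at x)"
    and cont: "continuous_on UNIV (\<lambda>x. f' x b)"
    and supp: "compact K" "\<And>x. x \<notin> K \<Longrightarrow> f x = 0"
  shows "integral\<^sup>L lborel (\<lambda>x. f' x b) = 0"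
proof -
  define g where "g x = f' x b" for x
  define q where "q n x = (f (x + inverse (real (Suc n)) *\<^sub>R b) - f x) / inverse (real (Suc n))" for n x
  have g0: "g x = 0" if "x \<notin> K" for x
    using has_derivative_eq_0_outside[OF D compact_imp_closed[OF supp(1)] supp(2) that]
    by (simp add: g_def)
  have contf: "continuous_on UNIV f"
    by (intro continuous_at_imp_continuous_on ballI has_derivative_continuous[OF D])
  have "bounded (g ` K)"
    by (intro compact_imp_bounded compact_continuous_image supp continuous_on_subset[OF cont[folded g_def]]) auto
  then obtain M where M: "0 < M" "\<And>x. x \<in> K \<Longrightarrow> \<bar>g x\<bar> \<le> M"
    unfolding bounded_pos by auto
  have gM: "\<bar>g x\<bar> \<le> M" for x
    using M g0 by (cases "x \<in> K") auto
  obtain R where R: "\<And>x. x \<in> K \<Longrightarrow> norm x \<le> R"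
    using compact_imp_bounded[OF supp(1)] unfolding bounded_iff by auto
  have line: "((\<lambda>t. f (x + t *\<^sub>R b)) has_real_derivative g (x + t *\<^sub>R b)) (at t)" for x t
    unfolding has_field_derivative_def
    by (rule has_derivative_eq_rhs[OF has_derivative_compose[OF _ D]])
      (auto intro!: derivative_eq_intros simp: g_def fun_eq_iff linear_cmul[OF has_derivative_linear[OF D]])
  have q_bound: "\<bar>q n x\<bar> \<le> M" for n x
  proof -
    have "\<exists>z>0. z < inverse (real (Suc n)) \<and>
        f (x + inverse (real (Suc n)) *\<^sub>R b) - f (x + 0 *\<^sub>R b) = (inverse (real (Suc n)) - 0) * g (x + z *\<^sub>R b)"
      by (rule MVT2) (auto intro: line)
    then obtain z where "f (x + inverse (real (Suc n)) *\<^sub>R b) - f x = inverse (real (Suc n)) * g (x + z *\<^sub>R b)"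
      by auto
    then have "q n x = g (x + z *\<^sub>R b)"
      unfolding q_def by (simp only:) simp
    then show ?thesis
      using gM by simp
  qed
  have f0: "f x = 0" if "R < norm x" for x
    using supp(2) R that by fastforce
  have q_supp: "q n x = 0" if "x \<notin> cball 0 (R + norm b)" for n x
  proof -
    have "norm x \<le> norm (x + inverse (real (Suc n)) *\<^sub>R b) + norm (inverse (real (Suc n)) *\<^sub>R b)"
      using norm_triangle_ineq4[of "x + inverse (real (Suc n)) *\<^sub>R b" "inverse (real (Suc n)) *\<^sub>R b"]
      by simp
    moreover have "norm (inverse (real (Suc n)) *\<^sub>R b) \<le> norm b"
      by (simp add: divide_simps mult_left_mono[of 1 "1 + real n" "norm b", simplified])
    moreover have "R + norm b < norm x"
      using that by simp
    ultimately have "R < norm (x + inverse (real (Suc n)) *\<^sub>R b)" "R < norm x"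
      using norm_ge_zero[of b] by linarith+
    then show ?thesis
      by (simp add: q_def f0)
  qed
  have q_lim: "(\<lambda>n. q n x) \<longlonglongrightarrow> g x" for x
  proof -
    have "filterlim (\<lambda>n. inverse (real (Suc n))) (at 0) sequentially"
      unfolding filterlim_at using LIMSEQ_inverse_real_of_nat by simp
    from filterlim_compose[OF DERIV_D[OF line[of x 0]] this] show ?thesis
      by (simp add: q_def)
  qed
  have intf: "integrable lborel f"
    by (rule continuous_compact_support_integrable[OF contf supp(2,1)])
  have int_q: "integral\<^sup>L lborel (q n) = 0" for n
  proof -
    define v where "v = inverse (real (Suc n)) *\<^sub>R b"
    have eq: "integral\<^sup>L lborel (\<lambda>x. f (v + x)) = integral\<^sup>L lborel f"
    proof -
      have "integral\<^sup>L lborel f = integral\<^sup>L (distr lborel borel ((+) v)) f"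
        by (simp add: lborel_distr_plus)
      also have "\<dots> = integral\<^sup>L lborel (\<lambda>x. f (v + x))"
        by (rule integral_distr) (use contf in \<open>auto intro: borel_measurable_continuous_onI\<close>)
      finally show ?thesis by simp
    qed
    have int: "integrable lborel (\<lambda>x. f (v + x))"
    proof -
      have "integrable (distr lborel borel ((+) v)) f"
        using intf by (simp add: lborel_distr_plus)
      then show ?thesis
        by (subst (asm) integrable_distr_eq)
          (use contf in \<open>auto intro: borel_measurable_continuous_onI\<close>)
    qed
    have "q n = (\<lambda>x. (f (v + x) - f x) / inverse (real (Suc n)))"
      by (simp add: q_def v_def fun_eq_iff add.commute)
    then show ?thesis
      using int intf eq by simp
  qed
  have "(\<lambda>n. integral\<^sup>L lborel (q n)) \<longlonglongrightarrow> integral\<^sup>L lborel g"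
  proof (rule integral_dominated_convergence[where w = "\<lambda>x. M * indicator (cball 0 (R + norm b)) x"])
    have "integrable lborel (indicator (cball (0::'a) (R + norm b)) :: 'a \<Rightarrow> real)"
      by (intro integrable_real_indicator emeasure_lborel_cball_finite) auto
    then show "integrable lborel (\<lambda>x::'a. M * indicator (cball 0 (R + norm b)) x)"
      by simp
    show "AE x in lborel. norm (q n x) \<le> M * indicator (cball 0 (R + norm b)) x" for n
      using q_bound q_supp by (auto simp: indicator_def)
    show "g \<in> borel_measurable lborel"
      using cont unfolding g_def by (simp add: borel_measurable_continuous_onI)
    show "q n \<in> borel_measurable lborel" for n
      unfolding q_def using contf
      by (auto intro!: borel_measurable_continuous_onI continuous_intros continuous_on_compose2[OF contf])
  qed (use q_lim in auto)
  then show ?thesis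
    using int_q by (simp add: LIMSEQ_const_iff g_def[abs_def])
qed

lemma test_functionsD:
  assumes "\<phi> \<in> test_functions \<Omega>"
  shows "(\<phi> has_derivative frechet_derivative \<phi> (at x)) (at x)"
    and "b \<in> Basis \<Longrightarrow> continuous_on UNIV (\<lambda>x. frechet_derivative \<phi> (at x) b)"
    and "continuous_on UNIV \<phi>"
    and "compact (closure {x. \<phi> x \<noteq> 0})" "closure {x. \<phi> x \<noteq> 0} \<subseteq> \<Omega>"
    and "x \<notin> closure {x. \<phi> x \<noteq> 0} \<Longrightarrow> \<phi> x = 0"
    and "x \<notin> closure {x. \<phi> x \<noteq> 0} \<Longrightarrow> frechet_derivative \<phi> (at x) = (\<lambda>_. 0)"
proof -
  have C: "C_diff (Suc 0) \<phi>" and "C_diff 0 \<phi>"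
    using assms unfolding test_functions_def by blast+
  show 1: "(\<phi> has_derivative frechet_derivative \<phi> (at x)) (at x)" for x
    using C by (rule C_diff_SucD)
  show "continuous_on UNIV (\<lambda>x. frechet_derivative \<phi> (at x) b)" if "b \<in> Basis"
    using C_diff_SucD(2)[OF C that] by simp
  show "continuous_on UNIV \<phi>"
    using \<open>C_diff 0 \<phi>\<close> by simp
  show "compact (closure {x. \<phi> x \<noteq> 0})" "closure {x. \<phi> x \<noteq> 0} \<subseteq> \<Omega>"
    using assms by (auto simp: test_functions_def)
  show 2: "\<phi> x = 0" if "x \<notin> closure {x. \<phi> x \<noteq> 0}" for x
    using that subsetD[OF closure_subset, of x "{x. \<phi> x \<noteq> 0}"] by auto
  show "frechet_derivative \<phi> (at x) = (\<lambda>_. 0)" if "x \<notin> closure {x. \<phi> x \<noteq> 0}"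
    by (rule has_derivative_eq_0_outside[OF 1 _ 2 that]) auto
qed

lemma lebesgue_on_integral_eq_lborel:
  fixes f :: "'a::euclidean_space \<Rightarrow> real"
  assumes "S \<in> sets lebesgue" "f \<in> borel_measurable borel" "\<And>x. x \<notin> S \<Longrightarrow> f x = 0"
  shows "integral\<^sup>L (lebesgue_on S) f = integral\<^sup>L lborel f"
proof -
  have "integral\<^sup>L (lebesgue_on S) f = integral\<^sup>L lebesgue (\<lambda>x. indicator S x *\<^sub>R f x)"
    using assms(1) by (intro integral_restrict_space) simp
  also have "(\<lambda>x. indicator S x *\<^sub>R f x) = f"
    using assms(3) by (auto simp: fun_eq_iff indicator_def)
  finally show ?thesis
    using assms(2) by (simp add: integral_completion)
qed

lemma continuous_locally_integrable_on:
  fixes f :: "'a::euclidean_space \<Rightarrow> 'b::euclidean_space"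
  assumes "continuous_on UNIV f"
  shows "f locally_integrable_on \<Omega>"
  unfolding locally_integrable_on_def
proof (intro allI impI)
  fix K assume K: "compact K \<and> K \<subseteq> \<Omega>"
  have "integrable lborel (\<lambda>x. indicator K x *\<^sub>R f x)"
    by (intro borel_integrable_compact continuous_on_subset[OF assms]) (use K in auto)
  then show "f absolutely_integrable_on K"
    unfolding set_integrable_def
    by (subst integrable_completion) (auto dest: borel_measurable_integrable)
qed

text \<open>Apply \<open>integral_directional_derivative_eq_0\<close> to the product of the function with a test function and
  use the product rule. The product has compact support in \<open>\<Omega>\<close>, so integrals over \<open>\<Omega>\<close> are
  integrals over the whole space.\<close>

lemma C1_has_weak_gradient:
  fixes u :: "'a::euclidean_space \<Rightarrow> real"
  assumes "open \<Omega>" and D: "\<And>x. (u has_derivative (\<lambda>h. G x \<bullet> h)) (at x)"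
    and contG: "continuous_on UNIV G"
  shows "has_weak_gradient \<Omega> u G"
  unfolding has_weak_gradient_def
proof (intro conjI ballI)
  have contu: "continuous_on UNIV u"
    by (intro continuous_at_imp_continuous_on ballI has_derivative_continuous[OF D])
  show "u locally_integrable_on \<Omega>" "G locally_integrable_on \<Omega>"
    by (intro continuous_locally_integrable_on contu contG)+
  fix \<phi> b assume \<phi>: "\<phi> \<in> test_functions \<Omega>" and b: "(b::'a) \<in> Basis"
  note T = test_functionsD[OF \<phi>]
  define K where "K = closure {x. \<phi> x \<noteq> 0}"
  note T = T[folded K_def]
  let ?A = "\<lambda>x. u x * frechet_derivative \<phi> (at x) b" and ?B = "\<lambda>x. (G x \<bullet> b) * \<phi> x"
  have cont: "continuous_on UNIV ?A" "continuous_on UNIV ?B"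
    by (intro continuous_intros contu contG T b)+
  have zero: "?A x = 0" "?B x = 0" if "x \<notin> K" for x
    using T(6,7)[OF that] by auto
  have "integral\<^sup>L lborel (\<lambda>x. ?A x + ?B x) = 0"
    by (rule integral_directional_derivative_eq_0
        [where f = "\<lambda>x. u x * \<phi> x" and f' = "\<lambda>x h. u x * frechet_derivative \<phi> (at x) h + (G x \<bullet> h) * \<phi> x"
          and K = K])
      (use T(6) in \<open>auto intro!: has_derivative_mult D T(1,4) continuous_on_add cont\<close>)
  moreover have "integrable lborel ?A" "integrable lborel ?B"
    using continuous_compact_support_integrable[OF cont(1) zero(1) T(4)]
      continuous_compact_support_integrable[OF cont(2) zero(2) T(4)] by auto
  moreover have "integral\<^sup>L (lebesgue_on \<Omega>) ?A = integral\<^sup>L lborel ?A"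
    "integral\<^sup>L (lebesgue_on \<Omega>) ?B = integral\<^sup>L lborel ?B"
    using \<open>open \<Omega>\<close> subsetD[OF T(5)]
    by (auto intro!: lebesgue_on_integral_eq_lborel borel_measurable_continuous_onI cont zero
        simp del: mult_eq_0_iff)
  ultimately show "integral\<^sup>L (lebesgue_on \<Omega>) ?A = - integral\<^sup>L (lebesgue_on \<Omega>) ?B"
    by simp
qed

section \<open>Uniqueness of the weak gradient\<close>

text \<open>Boxes form a generator of the Borel sets that is closed under intersection, so the sets with
  vanishing integral include all Borel sets by Dynkin's argument, and a function all of whose
  integrals vanish is zero almost everywhere. A Borel representative is used because boxes
  generate the Borel sets but not the Lebesgue measurable ones.\<close>

lemma AE_zero_if_box_integrals_zero:
  fixes g :: "'a::euclidean_space \<Rightarrow> real"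
  assumes int: "set_integrable lebesgue (box c d) g"
    and zero: "\<And>a b. box a b \<subseteq> box c d \<Longrightarrow> set_lebesgue_integral lebesgue (box a b) g = 0"
  shows "AE x in lebesgue. x \<in> box c d \<longrightarrow> g x = 0"
proof -
  define h where "h x = indicator (box c d) x * g x" for x
  have h: "integrable lebesgue h"
    using int by (simp add: set_integrable_def h_def[abs_def])
  obtain h' where h'm [measurable]: "h' \<in> borel_measurable lborel" and eq: "AE x in lborel. h x = h' x"
    using completion_ex_borel_measurable_real[OF borel_measurable_integrable[OF h]] by blast
  have eqL: "AE x in lebesgue. h x = h' x"
    using eq by (rule AE_completion)
  have "integrable lebesgue h'"
    by (rule integrable_cong_AE_imp[OF h _ eqL]) (simp add: measurable_completion)
  then have h': "integrable lborel h'"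
    by (simp add: integrable_completion)
  have seth': "set_integrable lborel A h'" if "A \<in> sets borel" for A
    unfolding set_integrable_def using that by (intro integrable_mult_indicator h') simp
  have box0: "set_lebesgue_integral lborel (box a b) h' = 0" for a b
  proof -
    have "set_lebesgue_integral lborel (box a b) h' = set_lebesgue_integral lebesgue (box a b) h'"
      unfolding set_lebesgue_integral_def by (simp add: integral_completion)
    also have "\<dots> = set_lebesgue_integral lebesgue (box a b) h"
      unfolding set_lebesgue_integral_def
    proof (rule integral_cong_AE)
      show "AE x in lebesgue. indicator (box a b) x *\<^sub>R h' x = indicator (box a b) x *\<^sub>R h x"
        using eqL by eventually_elim simp
    qed (intro borel_measurable_scaleR borel_measurable_indicator measurable_completion[OF h'm]
        borel_measurable_integrable[OF h], simp)+
    also have "\<dots> = set_lebesgue_integral lebesgue (box a b \<inter> box c d) g"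
      unfolding set_lebesgue_integral_def
      by (rule Bochner_Integration.integral_cong) (auto simp: h_def indicator_def)
    also have "\<dots> = 0"
      unfolding box_Int_box by (rule zero) (auto simp flip: box_Int_box)
    finally show ?thesis .
  qed
  have UN0: "integral\<^sup>L lborel h' = 0"
  proof -
    have "integral\<^sup>L lborel h' = integral\<^sup>L lebesgue h"
      using integral_cong_AE[OF borel_measurable_integrable[OF h] _ eqL]
      by (simp add: integral_completion measurable_completion)
    also have "\<dots> = 0"
      using zero[of c d] by (simp add: set_lebesgue_integral_def h_def[abs_def])
    finally show ?thesis .
  qed
  have "set_lebesgue_integral lborel A h' = 0" if "A \<in> sets lborel" for A
  proof -
    have "Int_stable (range (\<lambda>(a, b). box a b :: 'a set))"
      by (auto simp: Int_stable_def box_Int_box)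
    moreover have "range (\<lambda>(a, b). box a b :: 'a set) \<subseteq> Pow UNIV"
      by simp
    moreover have "A \<in> sigma_sets UNIV (range (\<lambda>(a, b). box a b))"
      using that unfolding sets_lborel borel_eq_box by simp
    ultimately show ?thesis
    proof (induction rule: sigma_sets_induct_disjoint)
      case (basic A)
      then show ?case using box0 by auto
    next
      case empty
      show ?case by (simp add: set_lebesgue_integral_def)
    next
      case (compl A)
      then have A: "A \<in> sets borel"
        unfolding borel_eq_box by simp
      have "integral\<^sup>L lborel h' = (LINT x|lborel. indicator A x *\<^sub>R h' x + indicator (UNIV - A) x *\<^sub>R h' x)"
        by (rule Bochner_Integration.integral_cong) (auto simp: indicator_def)
      also have "\<dots> = set_lebesgue_integral lborel A h' + set_lebesgue_integral lborel (UNIV - A) h'"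
        unfolding set_lebesgue_integral_def
        using seth'[of A] seth'[of "UNIV - A"] A by (simp add: set_integrable_def)
      finally show ?case
        using UN0 compl by simp
    next
      case (union A)
      then have A: "A i \<in> sets borel" for i
        unfolding borel_eq_box by auto
      have "set_lebesgue_integral lborel (\<Union>i. A i) h' = (\<Sum>i. set_lebesgue_integral lborel (A i) h')"
        by (rule lebesgue_integral_countable_add)
          (use A union(1) in \<open>auto intro!: seth' simp: disjoint_family_on_def\<close>)
      then show ?case
        using union by simp
    qed
  qed
  then have "AE x in lborel. h' x = 0"
    by (rule sigma_finite_measure.density_zero[OF lborel.sigma_finite_measure_axioms h'])
  then have "AE x in lebesgue. h' x = 0"
    by (rule AE_completion)
  with eqL show ?thesis
    by eventually_elim (auto simp: h_def)
qed

lemma locally_integrable_mult_test_function: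
  fixes g :: "'a::euclidean_space \<Rightarrow> real"
  assumes "open \<Omega>" and g: "g locally_integrable_on \<Omega>" and \<phi>: "\<phi> \<in> test_functions \<Omega>"
  shows "integrable (lebesgue_on \<Omega>) (\<lambda>x. g x * \<phi> x)"
proof -
  note T = test_functionsD[OF \<phi>]
  let ?K = "closure {x. \<phi> x \<noteq> 0}"
  have "(\<lambda>x. \<phi> x * g x) absolutely_integrable_on ?K"
  proof (rule absolutely_integrable_bounded_measurable_product[OF bilinear_times])
    show "\<phi> \<in> borel_measurable (lebesgue_on ?K)"
      by (intro continuous_imp_measurable_on_sets_lebesgue continuous_on_subset[OF T(3)]) auto
    show "bounded (\<phi> ` ?K)"
      by (intro compact_imp_bounded compact_continuous_image T(4) continuous_on_subset[OF T(3)]) auto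
    show "g absolutely_integrable_on ?K"
      using g T(4,5) by (auto simp: locally_integrable_on_def)
  qed auto
  moreover have "(\<lambda>x. indicator ?K x *\<^sub>R (\<phi> x * g x)) = (\<lambda>x. indicator \<Omega> x *\<^sub>R (g x * \<phi> x))"
  proof
    fix x
    show "indicator ?K x *\<^sub>R (\<phi> x * g x) = indicator \<Omega> x *\<^sub>R (g x * \<phi> x)"
      using subsetD[OF T(5), of x] T(6)[of x] by (cases "x \<in> ?K") simp_all
  qed
  ultimately show ?thesis
    using \<open>open \<Omega>\<close> by (simp add: set_integrable_def integrable_restrict_space)
qed

text \<open>The bumps of a box compactly contained in \<open>\<Omega>\<close> converge to its indicator, which gives
  vanishing integrals over boxes and hence vanishing almost everywhere on each box. Countably many
  boxes cover \<open>\<Omega>\<close>.\<close>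

lemma fundamental_lemma_calculus_of_variations:
  fixes g :: "'a::euclidean_space \<Rightarrow> real"
  assumes "open \<Omega>" and g: "g locally_integrable_on \<Omega>"
    and zero: "\<And>\<phi>. \<phi> \<in> test_functions \<Omega> \<Longrightarrow> (LINT x|lebesgue_on \<Omega>. g x * \<phi> x) = 0"
  shows "AE x in lebesgue_on \<Omega>. g x = 0"
proof -
  have box_zero: "set_lebesgue_integral lebesgue (box a b) g = 0" if ab: "cbox a b \<subseteq> \<Omega>" for a b
  proof -
    let ?\<phi> = "\<lambda>n. box_bump (real (Suc n)) a b"
    have intab: "set_integrable lebesgue (cbox a b) g"
      using g ab by (auto simp: locally_integrable_on_def)
    have "set_integrable lebesgue (box a b) g"
      by (rule set_integrable_subset[OF intab]) (auto simp: box_subset_cbox)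
    then have int: "integrable lebesgue (\<lambda>x. indicator (box a b) x *\<^sub>R g x)"
      by (simp add: set_integrable_def)
    have eq: "(LINT x|lebesgue_on \<Omega>. g x * ?\<phi> n x) =
        (LINT x|lebesgue. (indicator (box a b) x *\<^sub>R g x) * ?\<phi> n x)" for n
    proof -
      have "indicator \<Omega> x *\<^sub>R (g x * ?\<phi> n x) = (indicator (box a b) x *\<^sub>R g x) * ?\<phi> n x" for x
        using ab box_subset_cbox[of a b] box_bump_eq_0[of "real (Suc n)" x a b]
        by (cases "x \<in> box a b") (auto simp: indicator_def)
      then have "(LINT x|lebesgue. indicator \<Omega> x *\<^sub>R (g x * ?\<phi> n x)) =
          (LINT x|lebesgue. (indicator (box a b) x *\<^sub>R g x) * ?\<phi> n x)"
        by (intro Bochner_Integration.integral_cong refl)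
      moreover have "(LINT x|lebesgue_on \<Omega>. g x * ?\<phi> n x) = (LINT x|lebesgue. indicator \<Omega> x *\<^sub>R (g x * ?\<phi> n x))"
        using \<open>open \<Omega>\<close> by (intro integral_restrict_space) auto
      ultimately show ?thesis
        by (rule trans[rotated])
    qed
    have meas: "?\<phi> n \<in> borel_measurable lebesgue" for n
      using C_diff_imp_continuous[OF C_diff_box_bump]
      by (intro measurable_completion) (auto intro: borel_measurable_continuous_onI)
    have "(\<lambda>n. LINT x|lebesgue. (indicator (box a b) x *\<^sub>R g x) * ?\<phi> n x)
        \<longlonglongrightarrow> (LINT x|lebesgue. indicator (box a b) x *\<^sub>R g x)"
    proof (rule integral_dominated_convergence[where w = "\<lambda>x. norm (indicator (box a b) x *\<^sub>R g x)"])
      show "integrable lebesgue (\<lambda>x. norm (indicator (box a b) x *\<^sub>R g x))"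
        using int by (rule integrable_norm)
      show "(\<lambda>x. indicator (box a b) x *\<^sub>R g x) \<in> borel_measurable lebesgue"
        using int by (rule borel_measurable_integrable)
      then show "(\<lambda>x. (indicator (box a b) x *\<^sub>R g x) * ?\<phi> n x) \<in> borel_measurable lebesgue" for n
        using meas by (rule borel_measurable_times)
      have "(\<lambda>n. (indicator (box a b) x *\<^sub>R g x) * ?\<phi> n x) \<longlonglongrightarrow> (indicator (box a b) x *\<^sub>R g x) * indicator (box a b) x" for x
        by (intro tendsto_intros box_bump_tendsto)
      then show "AE x in lebesgue. (\<lambda>n. (indicator (box a b) x *\<^sub>R g x) * ?\<phi> n x)
          \<longlonglongrightarrow> indicator (box a b) x *\<^sub>R g x"
        by (intro AE_I2) (metis (no_types, lifting) indicator_simps mult.right_neutral mult_zero_left scaleR_zero_left)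
      show "AE x in lebesgue. norm ((indicator (box a b) x *\<^sub>R g x) * ?\<phi> n x) \<le> norm (indicator (box a b) x *\<^sub>R g x)" for n
        using mult_left_le[OF box_bump_bounds abs_ge_zero] by (intro AE_I2) (simp only: real_norm_def abs_mult)
    qed
    moreover have "(LINT x|lebesgue_on \<Omega>. g x * ?\<phi> n x) = 0" for n
      by (intro zero box_bump_test_function ab) simp
    ultimately show ?thesis
      unfolding eq set_lebesgue_integral_def by (simp add: LIMSEQ_const_iff)
  qed
  have box_AE: "AE x in lebesgue. x \<in> box c d \<longrightarrow> g x = 0" if cd: "cbox c d \<subseteq> \<Omega>" for c d
  proof (rule AE_zero_if_box_integrals_zero)
    have "set_integrable lebesgue (cbox c d) g"
      using g cd by (auto simp: locally_integrable_on_def)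
    then show "set_integrable lebesgue (box c d) g"
      by (rule set_integrable_subset) (auto simp: box_subset_cbox)
    show "set_lebesgue_integral lebesgue (box a b) g = 0" if sub: "box a b \<subseteq> box c d" for a b
    proof (cases "box a b = {}")
      case False
      then have "cbox a b \<subseteq> cbox c d"
        using closure_mono[OF sub] closure_box[of a b] closure_box[of c d] sub by (metis bot.extremum_uniqueI)
      then show ?thesis
        using box_zero cd by blast
    qed (simp add: set_lebesgue_integral_def)
  qed
  define F where "F = {box c d | c d. cbox c d \<subseteq> \<Omega>}"
  obtain F' where F': "F' \<subseteq> F" "countable F'" "\<Union>F' = \<Union>F"
    by (rule Lindelof[of F]) (auto simp: F_def)
  have "\<Omega> \<subseteq> \<Union>F"
  proof
    fix x assume "x \<in> \<Omega>"
    then obtain c d where "x \<in> box c d" "cbox c d \<subseteq> \<Omega>"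
      using open_contains_cbox[OF \<open>open \<Omega>\<close>] by metis
    then show "x \<in> \<Union>F"
      unfolding F_def by blast
  qed
  then have cover: "\<Omega> \<subseteq> \<Union>F'"
    using F' by simp
  have "AE x in lebesgue. \<forall>B\<in>F'. x \<in> B \<longrightarrow> g x = 0"
    using F' box_AE unfolding F_def by (intro AE_ball_countable') auto
  then have "AE x in lebesgue. x \<in> \<Omega> \<longrightarrow> g x = 0"
    by eventually_elim (use cover in blast)
  then show ?thesis
    using \<open>open \<Omega>\<close> by (subst AE_restrict_space_iff) auto
qed

lemma weak_gradient_unique:
  assumes "open \<Omega>" and G: "has_weak_gradient \<Omega> u G" and H: "has_weak_gradient \<Omega> u H"
  shows "AE x in lebesgue_on \<Omega>. G x = H x"
proof -
  have "AE x in lebesgue_on \<Omega>. G x \<bullet> b - H x \<bullet> b = 0" if b: "b \<in> Basis" for b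
  proof (rule fundamental_lemma_calculus_of_variations[OF \<open>open \<Omega>\<close>])
    have loc: "(\<lambda>x. G x \<bullet> b) locally_integrable_on \<Omega>" "(\<lambda>x. H x \<bullet> b) locally_integrable_on \<Omega>"
      using G H by (simp_all add: has_weak_gradient_def locally_integrable_on_def absolutely_integrable_component)
    then show "(\<lambda>x. G x \<bullet> b - H x \<bullet> b) locally_integrable_on \<Omega>"
      by (auto simp: locally_integrable_on_def)
    fix \<phi> assume \<phi>: "\<phi> \<in> test_functions \<Omega>"
    have "(LINT x|lebesgue_on \<Omega>. (G x \<bullet> b) * \<phi> x) = (LINT x|lebesgue_on \<Omega>. (H x \<bullet> b) * \<phi> x)"
    proof -
      have "(LINT x|lebesgue_on \<Omega>. u x * frechet_derivative \<phi> (at x) b) = - (LINT x|lebesgue_on \<Omega>. (G x \<bullet> b) * \<phi> x)"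
        "(LINT x|lebesgue_on \<Omega>. u x * frechet_derivative \<phi> (at x) b) = - (LINT x|lebesgue_on \<Omega>. (H x \<bullet> b) * \<phi> x)"
        using G H \<phi> b unfolding has_weak_gradient_def by blast+
      then show ?thesis
        by simp
    qed
    then show "(LINT x|lebesgue_on \<Omega>. (G x \<bullet> b - H x \<bullet> b) * \<phi> x) = 0"
      using loc[THEN locally_integrable_mult_test_function[OF \<open>open \<Omega>\<close> _ \<phi>]]
      by (simp add: left_diff_distrib)
  qed
  then have "AE x in lebesgue_on \<Omega>. \<forall>b\<in>Basis. G x \<bullet> b - H x \<bullet> b = 0"
    by (intro AE_finite_allI) auto
  then show ?thesis
    by eventually_elim (rule euclidean_eqI, simp)
qed

section \<open>Radial cutoff functions\<close>

text \<open>The cutoff functions need only be \<open>C\<^sup>1\<close>, so they can be assembled from this piecewise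
  quadratic function.\<close>

lemma DERIV_max_0_power2:
  "((\<lambda>t. (max 0 t)\<^sup>2) has_real_derivative 2 * max 0 t) (at (t :: real))"
proof (cases t "0 :: real" rule: linorder_cases)
  case less
  then have "((\<lambda>t. 0) has_real_derivative 2 * max 0 t) (at t)"
    by simp
  then show ?thesis
    by (rule has_field_derivative_transform_within_open[where S = "{..<0}"]) (use less in auto)
next
  case equal
  have "((\<lambda>h::real. max 0 h) \<longlongrightarrow> max 0 0) (at 0)"
    by (intro tendsto_max tendsto_const tendsto_ident_at)
  moreover have "eventually (\<lambda>h::real. max 0 h = ((max 0 (0 + h))\<^sup>2 - (max 0 0)\<^sup>2) / h) (at 0)"
    unfolding eventually_at_filter by (intro always_eventually) (auto simp: max_def power2_eq_square)
  ultimately have "((\<lambda>h::real. ((max 0 (0 + h))\<^sup>2 - (max 0 0)\<^sup>2) / h) \<longlongrightarrow> 0) (at 0)"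
    using Lim_transform_eventually by fastforce
  then show ?thesis
    using equal by (simp add: DERIV_def)
next
  case greater
  then have "((\<lambda>t. t\<^sup>2) has_real_derivative 2 * max 0 t) (at t)"
    by (auto intro!: derivative_eq_intros)
  then show ?thesis
    by (rule has_field_derivative_transform_within_open[where S = "{0<..}"]) (use greater in auto)
qed

text \<open>A \<open>C\<^sup>1\<close> step from \<open>0\<close> at \<open>t = 0\<close> to \<open>1\<close> at \<open>t = 1\<close>, the second primitive of the
  function equal to \<open>4\<close> on \<open>[0, 1/2]\<close>, to \<open>- 4\<close> on \<open>[1/2, 1]\<close>, and to \<open>0\<close> elsewhere.\<close>

definition smooth_step :: "real \<Rightarrow> real"
  where "smooth_step t = 2 * (max 0 t)\<^sup>2 - 4 * (max 0 (t - 1 / 2))\<^sup>2 + 2 * (max 0 (t - 1))\<^sup>2"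

definition smooth_step' :: "real \<Rightarrow> real"
  where "smooth_step' t = 4 * max 0 t - 8 * max 0 (t - 1 / 2) + 4 * max 0 (t - 1)"

lemma DERIV_smooth_step: "(smooth_step has_real_derivative smooth_step' t) (at t)"
proof -
  have D: "((\<lambda>t. (max 0 (t - c))\<^sup>2) has_real_derivative 2 * max 0 (t - c)) (at t)" for c t :: real
    by (rule DERIV_chain'[where f = "\<lambda>t. t - c" and E = "2 * max 0 (t - c)" and D = 1, OF _ DERIV_max_0_power2, THEN DERIV_cong])
      (auto intro!: derivative_eq_intros)
  show ?thesis
    unfolding smooth_step_def[abs_def] smooth_step'_def
    by (rule DERIV_cong[OF DERIV_add[OF DERIV_diff[OF DERIV_cmult[OF DERIV_max_0_power2]
            DERIV_cmult[OF D]] DERIV_cmult[OF D]]]) simp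
qed

lemma smooth_step_eq_0: "t \<le> 0 \<Longrightarrow> smooth_step t = 0"
  and smooth_step_eq_1: "1 \<le> t \<Longrightarrow> smooth_step t = 1"
  by (auto simp: smooth_step_def max_def power2_eq_square field_simps)

lemma smooth_step'_eq_0: "t \<le> 0 \<or> 1 \<le> t \<Longrightarrow> smooth_step' t = 0"
  and smooth_step'_bounds: "0 \<le> smooth_step' t" "smooth_step' t \<le> 2"
  by (auto simp: smooth_step'_def max_def)

lemma smooth_step_bounds: "0 \<le> smooth_step t" "smooth_step t \<le> 1"
proof -
  have mono: "smooth_step s \<le> smooth_step t" if "s \<le> t" for s t
    by (rule DERIV_nonneg_imp_nondecreasing[OF that]) (use DERIV_smooth_step smooth_step'_bounds in blast)
  show "0 \<le> smooth_step t" "smooth_step t \<le> 1"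
    using mono[of "min 0 t" t] mono[of t "max 1 t"] smooth_step_eq_0[of "min 0 t"] smooth_step_eq_1[of "max 1 t"]
    by auto
qed

lemma continuous_on_smooth_step': "continuous_on S smooth_step'"
  unfolding smooth_step'_def[abs_def] by (intro continuous_intros)

lemma continuous_on_smooth_step: "continuous_on S smooth_step"
  unfolding smooth_step_def[abs_def] by (intro continuous_intros)

definition plateau :: "real \<Rightarrow> real \<Rightarrow> real \<Rightarrow> real"
  where "plateau i j t = smooth_step (t - i) * smooth_step (j + 1 - t)"

definition plateau' :: "real \<Rightarrow> real \<Rightarrow> real \<Rightarrow> real"
  where "plateau' i j t =
    smooth_step' (t - i) * smooth_step (j + 1 - t) - smooth_step (t - i) * smooth_step' (j + 1 - t)"

lemma DERIV_plateau: "(plateau i j has_real_derivative plateau' i j t) (at t)"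
proof -
  have "((\<lambda>t. smooth_step (t - i)) has_real_derivative smooth_step' (t - i) * 1) (at t)"
    by (rule DERIV_chain'[OF _ DERIV_smooth_step, rotated, THEN DERIV_cong])
      (auto intro!: derivative_eq_intros)
  moreover have "((\<lambda>t. smooth_step (j + 1 - t)) has_real_derivative smooth_step' (j + 1 - t) * (- 1)) (at t)"
    by (rule DERIV_chain'[OF _ DERIV_smooth_step, rotated, THEN DERIV_cong])
      (auto intro!: derivative_eq_intros)
  ultimately show ?thesis
    unfolding plateau_def[abs_def] plateau'_def
    by (rule DERIV_mult[THEN DERIV_cong]) simp
qed

lemma continuous_on_plateau': "continuous_on S (plateau' i j)"
  unfolding plateau'_def[abs_def]
  by (intro continuous_intros continuous_on_compose2[OF continuous_on_smooth_step[of UNIV]]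
      continuous_on_compose2[OF continuous_on_smooth_step'[of UNIV]]) auto

lemma plateau_bounds: "0 \<le> plateau i j t" "plateau i j t \<le> 1"
  by (auto simp: plateau_def smooth_step_bounds mult_le_one)

lemma plateau_eq_0: "t \<le> i \<or> j + 1 \<le> t \<Longrightarrow> plateau i j t = 0"
  and plateau_eq_1: "i + 1 \<le> t \<Longrightarrow> t \<le> j \<Longrightarrow> plateau i j t = 1"
  by (auto simp: plateau_def smooth_step_eq_0 smooth_step_eq_1)

lemma plateau'_eq_0: "t \<le> i \<or> i + 1 \<le> t \<and> t \<le> j \<or> j + 1 \<le> t \<Longrightarrow> plateau' i j t = 0"
  by (auto simp: plateau'_def smooth_step_eq_0 smooth_step'_eq_0)

lemma plateau'_bound: "\<bar>plateau' i j t\<bar> \<le> 2"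
proof -
  have "0 \<le> smooth_step' a * smooth_step b" "smooth_step' a * smooth_step b \<le> 2" for a b
    using smooth_step'_bounds smooth_step_bounds mult_mono[of "smooth_step' a" 2 "smooth_step b" 1] by auto
  from this[of "t - i" "j + 1 - t"] this[of "j + 1 - t" "t - i"] show ?thesis
    by (auto simp: plateau'_def mult.commute)
qed

text \<open>A smooth substitute for the norm whose gradient has length less than \<open>1\<close>; using it
  avoids the singularity of the norm at the origin.\<close>

definition smooth_norm :: "'a::real_inner \<Rightarrow> real"
  where "smooth_norm x = sqrt (1 + x \<bullet> x)"

lemma smooth_norm_pos: "0 < smooth_norm x"
  by (simp add: smooth_norm_def add_pos_nonneg)

lemma norm_le_smooth_norm: "norm x \<le> smooth_norm x"
  by (simp add: smooth_norm_def norm_eq_sqrt_inner)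

lemma continuous_on_smooth_norm: "continuous_on S smooth_norm"
  unfolding smooth_norm_def[abs_def] by (intro continuous_intros)

lemma has_derivative_smooth_norm:
  "(smooth_norm has_derivative (\<lambda>h. (x \<bullet> h) / smooth_norm x)) (at x)"
proof -
  have "0 < 1 + x \<bullet> x"
    by (simp add: add_pos_nonneg)
  then show ?thesis
    unfolding smooth_norm_def[abs_def]
    by (auto intro!: derivative_eq_intros simp: fun_eq_iff inner_commute divide_simps)
qed

definition radial_cutoff :: "real \<Rightarrow> real \<Rightarrow> 'a::euclidean_space \<Rightarrow> real"
  where "radial_cutoff i j x = plateau i j (smooth_norm x)"

definition radial_cutoff_gradient :: "real \<Rightarrow> real \<Rightarrow> 'a::euclidean_space \<Rightarrow> 'a"
  where "radial_cutoff_gradient i j x = (plateau' i j (smooth_norm x) / smooth_norm x) *\<^sub>R x"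

lemma has_derivative_radial_cutoff:
  "(radial_cutoff i j has_derivative (\<lambda>h. radial_cutoff_gradient i j x \<bullet> h)) (at x)"
  unfolding radial_cutoff_def[abs_def] radial_cutoff_gradient_def
  by (rule has_derivative_eq_rhs[OF DERIV_compose_FDERIV[OF DERIV_plateau has_derivative_smooth_norm]])
    (auto simp: fun_eq_iff)

lemma continuous_on_radial_cutoff_gradient: "continuous_on S (radial_cutoff_gradient i j)"
  unfolding radial_cutoff_gradient_def[abs_def]
  by (intro continuous_intros continuous_on_smooth_norm
      continuous_on_compose2[OF continuous_on_plateau'[of UNIV]]) (auto simp: smooth_norm_pos less_imp_neq[symmetric])

lemma norm_radial_cutoff_gradient_le: "norm (radial_cutoff_gradient i j x) \<le> \<bar>plateau' i j (smooth_norm x)\<bar>"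
proof -
  have "norm (radial_cutoff_gradient i j x) = \<bar>plateau' i j (smooth_norm x)\<bar> * (norm x / smooth_norm x)"
    using smooth_norm_pos[of x] by (simp add: radial_cutoff_gradient_def)
  also have "\<dots> \<le> \<bar>plateau' i j (smooth_norm x)\<bar> * 1"
    using smooth_norm_pos[of x] norm_le_smooth_norm[of x] by (intro mult_left_mono) auto
  finally show ?thesis by simp
qed

section \<open>Annuli with comparatively light boundary layers\<close>

lemma power_over_exponential_tendsto_0: "(\<lambda>k. real k ^ n / 2 ^ k) \<longlonglongrightarrow> 0"
proof -
  have "filterlim (\<lambda>k. ln 2 * real k) at_top sequentially"
    by (intro filterlim_tendsto_pos_mult_at_top[OF tendsto_const] filterlim_real_sequentially) auto
  then have "(\<lambda>k. (ln 2 * real k) ^ n / exp (ln 2 * real k)) \<longlonglongrightarrow> 0"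
    by (rule filterlim_compose[OF tendsto_power_div_exp_0])
  then have "(\<lambda>k. (1 / ln 2 ^ n) * ((ln 2 * real k) ^ n / exp (ln 2 * real k))) \<longlonglongrightarrow> (1 / ln 2 ^ n) * 0"
    by (intro tendsto_mult tendsto_const)
  moreover have "exp (ln 2 * real k) = 2 ^ k" for k
    by (simp add: exp_of_nat2_mult)
  ultimately show ?thesis
    by (simp add: power_mult_distrib)
qed

text \<open>For large \<open>j\<close> the mass \<open>s j = m j - m (Suc i)\<close> is at least the fixed mass of the inner
  layer. If the outer
  layer \<open>m (Suc j) - m j\<close> were larger than \<open>s j\<close> for all large \<open>j\<close>, then \<open>s\<close> would double at each
  step, which is incompatible with polynomial growth.\<close>

lemma light_boundary_layers:
  fixes m :: "nat \<Rightarrow> real"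
  assumes nonneg: "\<And>k. 0 \<le> m k"
    and unbounded: "filterlim m at_top sequentially"
    and growth: "\<And>k. m k \<le> C * real k ^ n"
  shows "\<exists>j>i. 0 < m j - m (Suc i) \<and> m (Suc i) - m i \<le> m j - m (Suc i) \<and>
    m (Suc j) - m j \<le> m j - m (Suc i)"
proof (rule ccontr)
  assume contra: "\<not> ?thesis"
  define s where "s k = m k - m (Suc i)" for k
  have "eventually (\<lambda>k. m (Suc i) + max 1 (m (Suc i) - m i) \<le> m k) sequentially"
    using unbounded unfolding filterlim_at_top by blast
  then obtain k0 where k0: "\<And>k. k0 \<le> k \<Longrightarrow> m (Suc i) + max 1 (m (Suc i) - m i) \<le> m k"
    unfolding eventually_sequentially by blast
  \<comment> \<open>Taking \<open>J > i\<close> ensures that every \<open>k \<ge> J\<close> is a candidate for \<open>j\<close>.\<close>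
  define J where "J = max k0 (Suc i)"
  have large: "1 \<le> s k" "m (Suc i) - m i \<le> s k" if "J \<le> k" for k
    using k0[of k] that by (auto simp: s_def J_def)
  have double: "2 * s k \<le> s (Suc k)" if "J \<le> k" for k
  proof -
    have "i < k"
      using that by (auto simp: J_def)
    then have "\<not> m (Suc k) - m k \<le> m k - m (Suc i)"
      using contra large[OF that] by (force simp: s_def)
    then show ?thesis
      by (simp add: s_def)
  qed
  have exp_growth: "2 ^ t \<le> s (J + t)" for t
  proof (induction t)
    case 0
    show ?case using large(1)[of J] by simp
  next
    case (Suc t)
    then show ?case using double[of "J + t"] by simp
  qed
  have "(\<lambda>k. C * 2 ^ J * (real k ^ n / 2 ^ k)) \<longlonglongrightarrow> C * 2 ^ J * 0"
    by (intro tendsto_intros power_over_exponential_tendsto_0)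
  then have "eventually (\<lambda>k. C * 2 ^ J * (real k ^ n / 2 ^ k) < 1) sequentially"
    by (intro order_tendstoD(2)) auto
  then have "eventually (\<lambda>k. C * 2 ^ J * (real k ^ n / 2 ^ k) < 1 \<and> J \<le> k) sequentially"
    using eventually_ge_at_top[of J] by (rule eventually_conj)
  then obtain k where k: "C * 2 ^ J * (real k ^ n / 2 ^ k) < 1" "J \<le> k"
    using eventually_happens'[OF sequentially_bot] by blast
  then obtain t where t: "k = J + t"
    using le_Suc_ex by blast
  have "C * real k ^ n < 2 ^ t"
    using k(1) by (simp add: t power_add field_simps)
  also have "\<dots> \<le> s k"
    using exp_growth t by simp
  also have "\<dots> \<le> C * real k ^ n"
    using growth[of k] nonneg[of "Suc i"] by (simp add: s_def)
  finally show False
    by simp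
qed

section \<open>Weighted integrals\<close>

lemma bounded_support_weight_integrable:
  fixes f w :: "'a::euclidean_space \<Rightarrow> real"
  assumes "\<Omega> \<in> sets lebesgue"
    and meas: "f \<in> borel_measurable (lebesgue_on \<Omega>)" "w \<in> borel_measurable (lebesgue_on \<Omega>)"
    and w: "AE x in lebesgue_on \<Omega>. \<bar>w x\<bar> \<le> C"
    and f: "\<And>x. \<bar>f x\<bar> \<le> B" "\<And>x. x \<notin> cball 0 R \<Longrightarrow> f x = 0"
  shows "integrable (lebesgue_on \<Omega>) (\<lambda>x. f x * w x)"
proof (rule Bochner_Integration.integrable_bound)
  have "integrable lebesgue (indicator (\<Omega> \<inter> cball 0 R) :: 'a \<Rightarrow> real)"
  proof (rule integrable_real_indicator)
    show "\<Omega> \<inter> cball 0 R \<in> sets lebesgue"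
      using assms(1) by auto
    have "emeasure lebesgue (\<Omega> \<inter> cball 0 R) \<le> emeasure lebesgue (cball 0 R :: 'a set)"
      by (rule emeasure_mono) auto
    also have "\<dots> < \<infinity>"
      using emeasure_lborel_cball_finite[of "0 :: 'a" R] by simp
    finally show "emeasure lebesgue (\<Omega> \<inter> cball 0 R) < \<infinity>" .
  qed
  then have "integrable (lebesgue_on \<Omega>) (indicator (cball 0 R) :: 'a \<Rightarrow> real)"
    using assms(1) by (simp add: integrable_restrict_space indicator_inter_arith[abs_def])
  then show "integrable (lebesgue_on \<Omega>) (\<lambda>x. B * C * indicator (cball 0 R) x)"
    by (rule integrable_mult_right)
  show "(\<lambda>x. f x * w x) \<in> borel_measurable (lebesgue_on \<Omega>)"
    using meas by (rule borel_measurable_times)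
  show "AE x in lebesgue_on \<Omega>. norm (f x * w x) \<le> norm (B * C * indicator (cball 0 R) x)"
    using w
  proof eventually_elim
    case (elim x)
    show ?case
    proof (cases "x \<in> cball 0 R")
      case True
      have "\<bar>f x\<bar> * \<bar>w x\<bar> \<le> B * C"
        using f(1)[of x] elim by (intro mult_mono) auto
      then show ?thesis
        using True abs_ge_self[of "B * C"] by (simp add: abs_mult)
    qed (simp add: f(2))
  qed
qed

lemma integrable_imp_nn_integral_finite:
  fixes f :: "'a \<Rightarrow> real"
  assumes "integrable M f"
  shows "(\<integral>\<^sup>+x. ennreal (f x) \<partial>M) < \<infinity>"
proof -
  have "(\<integral>\<^sup>+x. ennreal (f x) \<partial>M) \<le> (\<integral>\<^sup>+x. ennreal (norm (f x)) \<partial>M)"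
    by (intro nn_integral_mono ennreal_leI) simp
  also have "\<dots> < \<infinity>"
    using assms by (simp add: integrable_iff_bounded)
  finally show ?thesis .
qed

lemma weighted_Lp_iff_integrable:
  assumes w: "weight_on \<Omega> w"
  shows "u \<in> weighted_Lp \<Omega> p w \<longleftrightarrow> u \<in> borel_measurable (lebesgue_on \<Omega>) \<and>
    integrable (lebesgue_on \<Omega>) (\<lambda>x. \<bar>u x\<bar> powr p * w x)"
proof -
  have wm [measurable]: "w \<in> borel_measurable (lebesgue_on \<Omega>)" and pos: "AE x in lebesgue_on \<Omega>. 0 < w x"
    using w by (auto simp: weight_on_def)
  have "integrable (lebesgue_on \<Omega>) (\<lambda>x. \<bar>u x\<bar> powr p * w x)"
    if [measurable]: "u \<in> borel_measurable (lebesgue_on \<Omega>)"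
      and fin: "(\<integral>\<^sup>+x. ennreal (\<bar>u x\<bar> powr p * w x) \<partial>lebesgue_on \<Omega>) < \<infinity>"
  proof (rule integrableI_nonneg)
    show "AE x in lebesgue_on \<Omega>. 0 \<le> \<bar>u x\<bar> powr p * w x"
      using pos by eventually_elim simp
  qed (use fin in auto)
  then show ?thesis
    by (auto simp: weighted_Lp_def dest: integrable_imp_nn_integral_finite)
qed

lemma powr_add_le:
  fixes a b p :: real
  assumes "0 \<le> p"
  shows "\<bar>a + b\<bar> powr p \<le> 2 powr p * (\<bar>a\<bar> powr p + \<bar>b\<bar> powr p)"
proof -
  have "\<bar>a + b\<bar> powr p \<le> (2 * max \<bar>a\<bar> \<bar>b\<bar>) powr p"
    using assms by (intro powr_mono2) auto
  also have "\<dots> = 2 powr p * max \<bar>a\<bar> \<bar>b\<bar> powr p"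
    by (simp add: powr_mult)
  also have "\<dots> \<le> 2 powr p * (\<bar>a\<bar> powr p + \<bar>b\<bar> powr p)"
    by (intro mult_left_mono) (auto simp: max_def)
  finally show ?thesis .
qed

lemma weighted_Lp_diff:
  assumes w: "weight_on \<Omega> w" and "0 \<le> p" and u: "u \<in> weighted_Lp \<Omega> p w" and v: "v \<in> weighted_Lp \<Omega> p w"
  shows "(\<lambda>x. u x - v x) \<in> weighted_Lp \<Omega> p w"
proof -
  have [measurable]: "w \<in> borel_measurable (lebesgue_on \<Omega>)" "u \<in> borel_measurable (lebesgue_on \<Omega>)"
      "v \<in> borel_measurable (lebesgue_on \<Omega>)"
    and pos: "AE x in lebesgue_on \<Omega>. 0 < w x"
    using w u v by (auto simp: weight_on_def weighted_Lp_def)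
  have "integrable (lebesgue_on \<Omega>) (\<lambda>x. \<bar>u x - v x\<bar> powr p * w x)"
  proof (rule Bochner_Integration.integrable_bound)
    show "integrable (lebesgue_on \<Omega>) (\<lambda>x. 2 powr p * (\<bar>u x\<bar> powr p * w x + \<bar>v x\<bar> powr p * w x))"
      using u v by (auto simp: weighted_Lp_iff_integrable[OF w])
    show "AE x in lebesgue_on \<Omega>. norm (\<bar>u x - v x\<bar> powr p * w x)
        \<le> norm (2 powr p * (\<bar>u x\<bar> powr p * w x + \<bar>v x\<bar> powr p * w x))"
      using pos
    proof eventually_elim
      case (elim x)
      have "\<bar>u x - v x\<bar> powr p * w x \<le> 2 powr p * (\<bar>u x\<bar> powr p + \<bar>v x\<bar> powr p) * w x"
        using powr_add_le[OF \<open>0 \<le> p\<close>, of "u x" "- v x"] elim by (intro mult_right_mono) auto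
      then show ?case
        using elim by (simp add: algebra_simps)
    qed
  qed simp
  then show ?thesis
    by (simp add: weighted_Lp_iff_integrable[OF w])
qed

text \<open>A continuous function of bounded support has finite weighted norm because the weight is
  bounded. The norm may be computed with the classical gradient, since it agrees almost everywhere
  with the chosen weak one.\<close>

lemma C1_bounded_support_weighted_W1p:
  fixes u :: "'a::euclidean_space \<Rightarrow> real"
  assumes "open \<Omega>" and w: "weight_on \<Omega> w" and "0 \<le> p"
    and C: "AE x in lebesgue_on \<Omega>. \<bar>w x\<bar> \<le> C"
    and D: "\<And>x. (u has_derivative (\<lambda>h. G x \<bullet> h)) (at x)" and contG: "continuous_on UNIV G"
    and supp: "\<And>x. x \<notin> cball 0 R \<Longrightarrow> u x = 0"
  shows "u \<in> weighted_W1p \<Omega> p w"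
    and "weighted_W1p_norm \<Omega> p w u = ((LINT x|lebesgue_on \<Omega>. \<bar>u x\<bar> powr p * w x) +
      (LINT x|lebesgue_on \<Omega>. norm (G x) powr p * w x)) powr (1 / p)"
    and "integrable (lebesgue_on \<Omega>) (\<lambda>x. \<bar>u x\<bar> powr p * w x)"
    and "integrable (lebesgue_on \<Omega>) (\<lambda>x. norm (G x) powr p * w x)"
proof -
  have wm [measurable]: "w \<in> borel_measurable (lebesgue_on \<Omega>)"
    using w by (simp add: weight_on_def)
  have contu: "continuous_on UNIV u"
    by (intro continuous_at_imp_continuous_on ballI has_derivative_continuous[OF D])
  have suppG: "G x = 0" if "x \<notin> cball 0 R" for x
  proof -
    have "(\<lambda>h. G x \<bullet> h) = (\<lambda>_. 0)"
      by (rule has_derivative_eq_0_outside[OF D closed_cball supp that])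
    then show ?thesis
      by (metis inner_eq_zero_iff)
  qed
  have int: "integrable (lebesgue_on \<Omega>) (\<lambda>x. norm (f x) powr p * w x)"
    and meas: "f \<in> borel_measurable (lebesgue_on \<Omega>)"
    if cont: "continuous_on UNIV f" and f0: "\<And>x. x \<notin> cball 0 R \<Longrightarrow> f x = 0" for f :: "'a \<Rightarrow> 'b::euclidean_space"
  proof -
    show fm [measurable]: "f \<in> borel_measurable (lebesgue_on \<Omega>)"
      using continuous_on_subset[OF cont] \<open>open \<Omega>\<close>
      by (intro continuous_imp_measurable_on_sets_lebesgue) auto
    have "bounded (f ` cball 0 R)"
      by (intro compact_imp_bounded compact_continuous_image continuous_on_subset[OF cont]) auto
    then obtain B where B: "0 < B" "\<And>x. x \<in> cball 0 R \<Longrightarrow> norm (f x) \<le> B"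
      unfolding bounded_pos by auto
    have "norm (f x) \<le> B" for x
      using B f0 by (cases "x \<in> cball 0 R") auto
    then show "integrable (lebesgue_on \<Omega>) (\<lambda>x. norm (f x) powr p * w x)"
      using \<open>open \<Omega>\<close> \<open>0 \<le> p\<close> f0
      by (intro bounded_support_weight_integrable[OF _ _ wm C, where B = "B powr p" and R = R])
        (auto intro: powr_mono2)
  qed
  show intu: "integrable (lebesgue_on \<Omega>) (\<lambda>x. \<bar>u x\<bar> powr p * w x)"
    using int[OF contu supp] by simp
  show intG: "integrable (lebesgue_on \<Omega>) (\<lambda>x. norm (G x) powr p * w x)"
    by (rule int[OF contG suppG])
  have weak: "has_weak_gradient \<Omega> u G"
    by (rule C1_has_weak_gradient[OF \<open>open \<Omega>\<close> D contG])
  have "(\<lambda>x. G x \<bullet> b) \<in> weighted_Lp \<Omega> p w" for b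
  proof -
    have "continuous_on UNIV (\<lambda>x. G x \<bullet> b)" "\<And>x. x \<notin> cball 0 R \<Longrightarrow> G x \<bullet> b = 0"
      using suppG by (auto intro: continuous_intros contG)
    from int[OF this] meas[OF this] show ?thesis
      by (simp add: weighted_Lp_iff_integrable[OF w])
  qed
  moreover have "u \<in> weighted_Lp \<Omega> p w"
    using intu meas[OF contu supp] by (simp add: weighted_Lp_iff_integrable[OF w])
  ultimately show "u \<in> weighted_W1p \<Omega> p w"
    using weak unfolding weighted_W1p_def by auto
  have weak': "has_weak_gradient \<Omega> u (weak_gradient \<Omega> u)"
    unfolding weak_gradient_def using someI[of "has_weak_gradient \<Omega> u", OF weak] .
  have "(LINT x|lebesgue_on \<Omega>. norm (weak_gradient \<Omega> u x) powr p * w x) =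
      (LINT x|lebesgue_on \<Omega>. norm (G x) powr p * w x)"
  proof -
    have \<Omega>: "\<Omega> \<in> sets lebesgue"
      using \<open>open \<Omega>\<close> by auto
    have "AE x in lebesgue. x \<in> \<Omega> \<longrightarrow> G x = weak_gradient \<Omega> u x"
      using weak_gradient_unique[OF \<open>open \<Omega>\<close> weak weak'] \<Omega> by (simp add: AE_restrict_space_iff)
    then have ae: "AE x in lebesgue. indicator \<Omega> x *\<^sub>R (norm (G x) powr p * w x) =
        indicator \<Omega> x *\<^sub>R (norm (weak_gradient \<Omega> u x) powr p * w x)"
      by eventually_elim (auto simp: indicator_def)
    have "integrable lebesgue (\<lambda>x. indicator \<Omega> x *\<^sub>R (norm (G x) powr p * w x))"
      using intG \<Omega> by (simp add: integrable_restrict_space)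
    then have m: "(\<lambda>x. indicator \<Omega> x *\<^sub>R (norm (G x) powr p * w x)) \<in> borel_measurable lebesgue"
      by (rule borel_measurable_integrable)
    have "(LINT x|lebesgue. indicator \<Omega> x *\<^sub>R (norm (G x) powr p * w x)) =
        (LINT x|lebesgue. indicator \<Omega> x *\<^sub>R (norm (weak_gradient \<Omega> u x) powr p * w x))"
      by (rule integral_cong_AE[OF m borel_measurable_AE[OF m ae] ae])
    then show ?thesis
      using \<Omega> by (simp add: integral_restrict_space)
  qed
  then show "weighted_W1p_norm \<Omega> p w u = ((LINT x|lebesgue_on \<Omega>. \<bar>u x\<bar> powr p * w x) +
      (LINT x|lebesgue_on \<Omega>. norm (G x) powr p * w x)) powr (1 / p)"
    by (simp add: weighted_W1p_norm_def)
qed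

section \<open>Functions escaping to infinity\<close>

text \<open>If \<open>u (r k)\<close> converges to \<open>v\<close>, fix \<open>a\<close> such that \<open>u (r k)\<close> is close to \<open>v\<close> for all
  \<open>k \<ge> a\<close>, and then \<open>b\<close> so large that \<open>u (r b)\<close> vanishes wherever \<open>u (r a)\<close> does not. At such
  points \<open>u (r a) = (u (r a) - v) - (u (r b) - v)\<close>, so \<open>u (r a)\<close> would be small.\<close>

lemma escaping_functions_contradict_compactness:
  fixes u :: "nat \<Rightarrow> 'a::euclidean_space \<Rightarrow> real"
  assumes w: "weight_on \<Omega> w" and p: "0 < p"
    and compact: "compact_embedding X N (weighted_Lp \<Omega> p w) (weighted_Lp_norm \<Omega> p w)"
    and X: "\<And>i. u i \<in> X" and bdd: "\<And>i. \<bar>N (u i)\<bar> \<le> B"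
    and large: "\<And>i. 1 \<le> (LINT x|lebesgue_on \<Omega>. \<bar>u i x\<bar> powr p * w x)"
    and escape: "\<And>i x. u i x \<noteq> 0 \<Longrightarrow> real i < \<rho> x \<and> \<rho> x < real (J i)"
  shows False
proof -
  have sub: "X \<subseteq> weighted_Lp \<Omega> p w" and
    ex: "\<exists>v\<in>weighted_Lp \<Omega> p w. \<exists>r :: nat \<Rightarrow> nat. strict_mono r \<and>
      (\<lambda>k. weighted_Lp_norm \<Omega> p w (\<lambda>x. u (r k) x - v x)) \<longlonglongrightarrow> 0"
  proof -
    have "bounded (range (\<lambda>k. N (u k)))"
      unfolding bounded_iff using bdd by auto
    moreover have "range u \<subseteq> X"
      using X by auto
    ultimately show "X \<subseteq> weighted_Lp \<Omega> p w" "\<exists>v\<in>weighted_Lp \<Omega> p w. \<exists>r :: nat \<Rightarrow> nat. strict_mono r \<and>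
      (\<lambda>k. weighted_Lp_norm \<Omega> p w (\<lambda>x. u (r k) x - v x)) \<longlonglongrightarrow> 0"
      using compact unfolding compact_embedding_def by blast+
  qed
  from ex obtain v r where v: "v \<in> weighted_Lp \<Omega> p w" and r: "strict_mono r"
    and lim: "(\<lambda>k. weighted_Lp_norm \<Omega> p w (\<lambda>x. u (r k) x - v x)) \<longlonglongrightarrow> 0"
    by blast
  define A where "A k = (LINT x|lebesgue_on \<Omega>. \<bar>u (r k) x - v x\<bar> powr p * w x)" for k
  have pos: "AE x in lebesgue_on \<Omega>. 0 < w x"
    using w by (simp add: weight_on_def)
  have A_int: "integrable (lebesgue_on \<Omega>) (\<lambda>x. \<bar>u (r k) x - v x\<bar> powr p * w x)" for k
  proof -
    have "(\<lambda>x. u (r k) x - v x) \<in> weighted_Lp \<Omega> p w"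
      using X sub p by (intro weighted_Lp_diff[OF w _ _ v]) auto
    then show ?thesis
      by (simp add: weighted_Lp_iff_integrable[OF w])
  qed
  have A_nonneg: "0 \<le> A k" for k
    unfolding A_def by (rule integral_nonneg_AE) (use pos in \<open>eventually_elim, simp\<close>)
  \<comment> \<open>With both errors below this value, the estimate below gives the contradiction \<open>1 < 2 powr p * (2 * \<delta>) = 1 / 2\<close>.\<close>
  define \<delta> where "\<delta> = inverse (4 * 2 powr p)"
  have "0 < \<delta>"
    by (simp add: \<delta>_def)
  then have "eventually (\<lambda>k. weighted_Lp_norm \<Omega> p w (\<lambda>x. u (r k) x - v x) < \<delta> powr (1 / p)) sequentially"
    by (intro order_tendstoD(2)[OF lim]) simp
  then obtain a where a: "\<And>k. a \<le> k \<Longrightarrow> A k powr (1 / p) < \<delta> powr (1 / p)"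
    unfolding eventually_sequentially weighted_Lp_norm_def A_def by blast
  have A_small: "A k < \<delta>" if "a \<le> k" for k
  proof (rule ccontr)
    assume "\<not> A k < \<delta>"
    then have "\<delta> powr (1 / p) \<le> A k powr (1 / p)"
      using p \<open>0 < \<delta>\<close> by (intro powr_mono2) auto
    then show False
      using a[OF that] by simp
  qed
  define b where "b = max a (J (r a))"
  have "J (r a) \<le> r b"
    using seq_suble[OF r, of b] by (simp add: b_def)
  have ptw: "\<bar>u (r a) x\<bar> powr p \<le> 2 powr p * (\<bar>u (r a) x - v x\<bar> powr p + \<bar>u (r b) x - v x\<bar> powr p)" for x
  proof (cases "u (r a) x = 0")
    case True
    then show ?thesis by simp
  next
    case False
    have "u (r b) x = 0"
    proof (rule ccontr)
      assume "u (r b) x \<noteq> 0"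
      then have "real (r b) < real (J (r a))"
        using escape False by (meson less_trans)
      then show False
        using \<open>J (r a) \<le> r b\<close> by simp
    qed
    then show ?thesis
      using powr_add_le[of p "u (r a) x - v x" "v x"] p by simp
  qed
  have "1 \<le> (LINT x|lebesgue_on \<Omega>. \<bar>u (r a) x\<bar> powr p * w x)"
    by (rule large)
  also have "\<dots> \<le> (LINT x|lebesgue_on \<Omega>.
      2 powr p * (\<bar>u (r a) x - v x\<bar> powr p * w x + \<bar>u (r b) x - v x\<bar> powr p * w x))"
  proof (rule integral_mono_AE)
    show "integrable (lebesgue_on \<Omega>) (\<lambda>x. \<bar>u (r a) x\<bar> powr p * w x)"
      using subsetD[OF sub X[of "r a"]] by (simp add: weighted_Lp_iff_integrable[OF w])
    show "AE x in lebesgue_on \<Omega>. \<bar>u (r a) x\<bar> powr p * w x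
        \<le> 2 powr p * (\<bar>u (r a) x - v x\<bar> powr p * w x + \<bar>u (r b) x - v x\<bar> powr p * w x)"
      using pos
    proof eventually_elim
      case (elim x)
      then show ?case
        using mult_right_mono[OF ptw[of x], of "w x"] by (simp add: algebra_simps)
    qed
  qed (use A_int in auto)
  also have "\<dots> = 2 powr p * (A a + A b)"
    using A_int by (simp add: A_def)
  also have "\<dots> < 2 powr p * (\<delta> + \<delta>)"
    using A_small[of a] A_small[of b] by (intro mult_strict_left_mono add_strict_mono) (auto simp: b_def)
  also have "\<dots> = 1 / 2"
    by (simp add: \<delta>_def field_simps)
  finally show False
    by simp
qed

section \<open>The mass of balls and annuli\<close>

definition ball_mass :: "'a::euclidean_space set \<Rightarrow> ('a \<Rightarrow> real) \<Rightarrow> nat \<Rightarrow> real"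
  where "ball_mass \<Omega> w k = (LINT x|lebesgue_on \<Omega>. indicator {x. smooth_norm x < real k} x * w x)"

lemma annulus_in_cball: "{x::'a::euclidean_space. a \<le> smooth_norm x \<and> smooth_norm x < b} \<subseteq> cball 0 b"
  using norm_le_smooth_norm by (fastforce intro: order_trans less_imp_le)

lemma ball_eq_annulus: "{x::'a::euclidean_space. smooth_norm x < b} = {x. 0 \<le> smooth_norm x \<and> smooth_norm x < b}"
  using smooth_norm_pos less_imp_le by blast

context
  fixes \<Omega> :: "'a::euclidean_space set" and w :: "'a \<Rightarrow> real" and C :: real
  assumes \<Omega>: "open \<Omega>" and w: "weight_on \<Omega> w" and C: "AE x in lebesgue_on \<Omega>. \<bar>w x\<bar> \<le> C"
begin

private lemma weight_measurable: "w \<in> borel_measurable (lebesgue_on \<Omega>)"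
  and weight_pos: "AE x in lebesgue_on \<Omega>. 0 < w x"
  using w by (auto simp: weight_on_def)

private lemma sets_\<Omega>: "\<Omega> \<in> sets lebesgue"
  using \<Omega> by auto

lemma borel_measurable_indicator_annulus:
  "(indicator {x. a \<le> smooth_norm x \<and> smooth_norm x < b} :: 'a \<Rightarrow> real) \<in> borel_measurable (lebesgue_on \<Omega>)"
proof -
  have [measurable]: "(smooth_norm :: 'a \<Rightarrow> real) \<in> borel_measurable borel"
    by (rule borel_measurable_continuous_onI[OF continuous_on_smooth_norm])
  have "(indicator {x. a \<le> smooth_norm x \<and> smooth_norm x < b} :: 'a \<Rightarrow> real) \<in> borel_measurable borel"
    by measurable
  then show ?thesis
    by (intro measurable_restrict_space1 measurable_completion) simp
qed

lemma integrable_annulus: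
  "integrable (lebesgue_on \<Omega>) (\<lambda>x. indicator {x. a \<le> smooth_norm x \<and> smooth_norm x < b} x * w x)"
  by (rule bounded_support_weight_integrable[OF sets_\<Omega> borel_measurable_indicator_annulus weight_measurable C,
        where B = 1 and R = b])
    (use annulus_in_cball[of a b] in \<open>auto simp: indicator_def\<close>)

lemma integral_annulus:
  assumes "a \<le> b"
  shows "(LINT x|lebesgue_on \<Omega>. indicator {x. real a \<le> smooth_norm x \<and> smooth_norm x < real b} x * w x) =
    ball_mass \<Omega> w b - ball_mass \<Omega> w a"
proof -
  have "(LINT x|lebesgue_on \<Omega>. indicator {x. real a \<le> smooth_norm x \<and> smooth_norm x < real b} x * w x) =
    (LINT x|lebesgue_on \<Omega>. indicator {x. smooth_norm x < real b} x * w x - indicator {x. smooth_norm x < real a} x * w x)"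
    using assms by (intro Bochner_Integration.integral_cong) (auto simp: indicator_def)
  also have "\<dots> = ball_mass \<Omega> w b - ball_mass \<Omega> w a"
    unfolding ball_mass_def ball_eq_annulus
    by (intro Bochner_Integration.integral_diff integrable_annulus)
  finally show ?thesis .
qed

lemma ball_mass_nonneg: "0 \<le> ball_mass \<Omega> w k"
  unfolding ball_mass_def
  by (rule integral_nonneg_AE) (use weight_pos in \<open>eventually_elim, simp\<close>)

lemma ball_mass_growth:
  assumes "0 \<le> C"
  shows "ball_mass \<Omega> w k \<le> C * unit_ball_vol DIM('a) * real k ^ DIM('a)"
proof -
  have meas: "(\<lambda>x. indicator (cball (0::'a) (real k)) x :: real) \<in> borel_measurable (lebesgue_on \<Omega>)"
    by (intro measurable_restrict_space1 measurable_completion) (auto intro!: borel_measurable_indicator)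
  have int: "integrable (lebesgue_on \<Omega>) (\<lambda>x. indicator (cball (0::'a) (real k)) x * C)"
    by (rule bounded_support_weight_integrable[OF sets_\<Omega> meas, where B = 1 and R = "real k" and C = C])
      (use assms in \<open>auto simp: indicator_def\<close>)
  have "ball_mass \<Omega> w k \<le> (LINT x|lebesgue_on \<Omega>. indicator (cball 0 (real k)) x * C)"
    unfolding ball_mass_def ball_eq_annulus
  proof (rule integral_mono_AE[OF integrable_annulus int])
    show "AE x in lebesgue_on \<Omega>. indicator {x. 0 \<le> smooth_norm x \<and> smooth_norm x < real k} x * w x
        \<le> indicator (cball 0 (real k)) x * C"
      using C
    proof eventually_elim
      case (elim x)
      then show ?case
        using annulus_in_cball[of 0 "real k"] assms by (auto simp: indicator_def)
    qed
  qed
  also have "\<dots> = measure (lebesgue_on \<Omega>) (cball 0 (real k) \<inter> \<Omega>) * C"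
    by simp
  also have "measure (lebesgue_on \<Omega>) (cball 0 (real k) \<inter> \<Omega>) = measure lebesgue (cball 0 (real k) \<inter> \<Omega>)"
    using sets_\<Omega> by (intro measure_restrict_space) auto
  also have "measure lebesgue (cball 0 (real k) \<inter> \<Omega>) * C \<le> measure lebesgue (cball (0::'a) (real k)) * C"
    using sets_\<Omega> assms by (intro mult_right_mono measure_mono_fmeasurable) auto
  also have "\<dots> = C * unit_ball_vol DIM('a) * real k ^ DIM('a)"
    by (simp add: content_cball)
  finally show ?thesis .
qed

lemma ball_mass_mono: "k \<le> l \<Longrightarrow> ball_mass \<Omega> w k \<le> ball_mass \<Omega> w l"
proof -
  assume "k \<le> l"
  have "0 \<le> (LINT x|lebesgue_on \<Omega>. indicator {x. real k \<le> smooth_norm x \<and> smooth_norm x < real l} x * w x)"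
    by (rule integral_nonneg_AE) (use weight_pos in \<open>eventually_elim, simp\<close>)
  then show ?thesis
    using integral_annulus[OF \<open>k \<le> l\<close>] by simp
qed

text \<open>By monotone convergence, bounded masses of the balls would make the weight integrable.\<close>

lemma ball_mass_unbounded:
  assumes inf: "\<not> integrable (lebesgue_on \<Omega>) w"
  shows "filterlim (ball_mass \<Omega> w) at_top sequentially"
proof (rule ccontr)
  assume not: "\<not> ?thesis"
  have inc: "incseq (ball_mass \<Omega> w)"
    using ball_mass_mono by (auto simp: incseq_def)
  have "\<exists>B. \<forall>k. ball_mass \<Omega> w k \<le> B"
  proof (rule ccontr)
    assume "\<not> ?thesis"
    then have "\<exists>k. Z \<le> ball_mass \<Omega> w k" for Z
      by (meson linear)
    then have "filterlim (ball_mass \<Omega> w) at_top sequentially"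
      unfolding filterlim_at_top eventually_sequentially using inc by (meson incseq_def order_trans)
    then show False
      using not by simp
  qed
  then obtain B where "\<And>k. ball_mass \<Omega> w k \<le> B"
    by blast
  then obtain L where L: "ball_mass \<Omega> w \<longlonglongrightarrow> L"
    using incseq_convergent[OF inc] by blast
  have "integrable (lebesgue_on \<Omega>) w"
  proof (rule integrable_monotone_convergence[where f = "\<lambda>k x. indicator {x. smooth_norm x < real k} x * w x"])
    show "integrable (lebesgue_on \<Omega>) (\<lambda>x. indicator {x. smooth_norm x < real k} x * w x)" for k
      unfolding ball_eq_annulus by (rule integrable_annulus)
    show "AE x in lebesgue_on \<Omega>. mono (\<lambda>k. indicator {x. smooth_norm x < real k} x * w x)"
      using weight_pos by eventually_elim (auto simp: mono_def indicator_def)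
    show "AE x in lebesgue_on \<Omega>. (\<lambda>k. indicator {x. smooth_norm x < real k} x * w x) \<longlonglongrightarrow> w x"
    proof (rule AE_I2)
      fix x :: 'a
      obtain k0 :: nat where "smooth_norm x < real k0"
        using reals_Archimedean2 by blast
      then have "eventually (\<lambda>k. indicator {x. smooth_norm x < real k} x * w x = w x) sequentially"
        by (intro eventually_sequentiallyI[of k0]) auto
      then show "(\<lambda>k. indicator {x. smooth_norm x < real k} x * w x) \<longlonglongrightarrow> w x"
        by (rule tendsto_eventually)
    qed
    show "(\<lambda>k. LINT x|lebesgue_on \<Omega>. indicator {x. smooth_norm x < real k} x * w x) \<longlonglongrightarrow> L"
      using L by (simp add: ball_mass_def[abs_def])
  qed (rule weight_measurable)
  then show False
    using inf by simp
qed

text \<open>The plateau cutoff of the annulus, multiplied by \<open>s powr (- 1 / p)\<close> where \<open>s\<close> is the mass of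
  the annulus. Its \<open>p\<close>-th power integral is at most \<open>3\<close>: the annulus and each of the two layers
  contribute at most \<open>1\<close>. The gradient of the cutoff is bounded by \<open>2\<close> and lives on the layers, so
  the gradient integral is at most \<open>2 powr p * (2 * s) / s\<close>.\<close>

lemma normalized_annular_function:
  assumes p: "1 \<le> p" and ij: "i < j"
    and s: "0 < ball_mass \<Omega> w j - ball_mass \<Omega> w (Suc i)"
    and inner: "ball_mass \<Omega> w (Suc i) - ball_mass \<Omega> w i \<le> ball_mass \<Omega> w j - ball_mass \<Omega> w (Suc i)"
    and outer: "ball_mass \<Omega> w (Suc j) - ball_mass \<Omega> w j \<le> ball_mass \<Omega> w j - ball_mass \<Omega> w (Suc i)"
  obtains u where "u \<in> weighted_W1p \<Omega> p w"
    and "\<bar>weighted_W1p_norm \<Omega> p w u\<bar> \<le> (3 + 2 * 2 powr p) powr (1 / p)"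
    and "1 \<le> (LINT x|lebesgue_on \<Omega>. \<bar>u x\<bar> powr p * w x)"
    and "\<And>x. u x \<noteq> 0 \<Longrightarrow> real i < smooth_norm x \<and> smooth_norm x < real (Suc j)"
proof -
  let ?m = "ball_mass \<Omega> w"
  define s where "s = ?m j - ?m (Suc i)"
  define c where "c = s powr (- 1 / p)"
  define u where "u x = c * radial_cutoff (real i) (real j) x" for x :: 'a
  define G where "G x = c *\<^sub>R radial_cutoff_gradient (real i) (real j) x" for x :: 'a
  define ann :: "nat \<Rightarrow> nat \<Rightarrow> 'a \<Rightarrow> real"
    where "ann a b x = indicator {x. real a \<le> smooth_norm x \<and> smooth_norm x < real b} x" for a b x
  have "0 < s"
    using s by (simp add: s_def)
  have "0 < c"
    using \<open>0 < s\<close> by (simp add: c_def)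
  have cp: "c powr p = 1 / s"
    unfolding c_def powr_powr using p \<open>0 < s\<close> by (simp add: powr_minus_divide)
  have ann_int: "integrable (lebesgue_on \<Omega>) (\<lambda>x. ann a b x * w x)" for a b
    unfolding ann_def by (rule integrable_annulus)
  have ann_mass: "(LINT x|lebesgue_on \<Omega>. ann a b x * w x) = ?m b - ?m a" if "a \<le> b" for a b
    unfolding ann_def by (rule integral_annulus[OF that])
  have D: "(u has_derivative (\<lambda>h. G x \<bullet> h)) (at x)" for x
    unfolding u_def[abs_def] G_def
    by (rule has_derivative_eq_rhs[OF has_derivative_mult_right[OF has_derivative_radial_cutoff]]) simp
  have contG: "continuous_on UNIV G"
    unfolding G_def[abs_def] by (intro continuous_intros continuous_on_radial_cutoff_gradient)
  have supp: "real i < smooth_norm x \<and> smooth_norm x < real (Suc j)" if "u x \<noteq> 0" for x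
    using that plateau_eq_0[of "smooth_norm x" "real i" "real j"]
    by (force simp: u_def radial_cutoff_def)
  have supp': "u x = 0" if "x \<notin> cball 0 (real (Suc j))" for x
    using supp[of x] norm_le_smooth_norm[of x] that by force
  have "0 \<le> p"
    using p by simp
  note W = C1_bounded_support_weighted_W1p[OF \<Omega> w \<open>0 \<le> p\<close> C D contG supp']
  have upper: "\<bar>u x\<bar> powr p \<le> (1 / s) * ann i (Suc j) x" for x
  proof (cases "u x = 0")
    case False
    have "\<bar>u x\<bar> powr p \<le> c powr p"
      using \<open>0 < c\<close> p plateau_bounds[of "real i" "real j" "smooth_norm x"]
      by (intro powr_mono2) (auto simp: u_def radial_cutoff_def abs_mult mult_le_cancel_left1)
    then show ?thesis
      using supp[OF False] by (simp add: ann_def cp)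
  qed (use \<open>0 < s\<close> in \<open>simp add: ann_def\<close>)
  have lower: "(1 / s) * ann (Suc i) j x \<le> \<bar>u x\<bar> powr p" for x
    using plateau_eq_1[of "real i" "smooth_norm x" "real j"] \<open>0 < c\<close>
    by (auto simp: ann_def indicator_def u_def radial_cutoff_def cp)
  have gradient: "norm (G x) powr p \<le> (2 powr p / s) * (ann i (Suc i) x + ann j (Suc j) x)" for x
  proof (cases "plateau' (real i) (real j) (smooth_norm x) = 0")
    case True
    then show ?thesis
      using \<open>0 < s\<close> by (simp add: G_def radial_cutoff_gradient_def ann_def)
  next
    case False
    then have "\<not> (smooth_norm x \<le> real i \<or> real i + 1 \<le> smooth_norm x \<and> smooth_norm x \<le> real j \<or> real j + 1 \<le> smooth_norm x)"
      using plateau'_eq_0 by blast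
    then have "1 \<le> ann i (Suc i) x + ann j (Suc j) x"
      by (auto simp: ann_def indicator_def not_le)
    then have "2 powr p / s \<le> (2 powr p / s) * (ann i (Suc i) x + ann j (Suc j) x)"
      using mult_left_mono[of 1 _ "2 powr p / s"] \<open>0 < s\<close> by simp
    moreover have "norm (G x) powr p \<le> (c * 2) powr p"
      using norm_radial_cutoff_gradient_le[of "real i" "real j" x]
        plateau'_bound[of "real i" "real j" "smooth_norm x"] \<open>0 < c\<close> p
      by (intro powr_mono2) (auto simp: G_def)
    ultimately show ?thesis
      using \<open>0 < c\<close> by (simp add: powr_mult cp)
  qed
  have one: "1 \<le> (LINT x|lebesgue_on \<Omega>. \<bar>u x\<bar> powr p * w x)"
  proof -
    have "1 = (LINT x|lebesgue_on \<Omega>. (1 / s) * (ann (Suc i) j x * w x))"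
      using ann_mass[of "Suc i" j] ij \<open>0 < s\<close> by (simp add: s_def)
    also have "\<dots> \<le> (LINT x|lebesgue_on \<Omega>. \<bar>u x\<bar> powr p * w x)"
    proof (rule integral_mono_AE[OF integrable_mult_right[OF ann_int] W(3)])
      show "AE x in lebesgue_on \<Omega>. (1 / s) * (ann (Suc i) j x * w x) \<le> \<bar>u x\<bar> powr p * w x"
        using weight_pos by eventually_elim (metis lower mult.assoc mult_right_mono less_imp_le)
    qed
    finally show ?thesis .
  qed
  have three: "(LINT x|lebesgue_on \<Omega>. \<bar>u x\<bar> powr p * w x) \<le> 3"
  proof -
    have "(LINT x|lebesgue_on \<Omega>. \<bar>u x\<bar> powr p * w x) \<le> (LINT x|lebesgue_on \<Omega>. (1 / s) * (ann i (Suc j) x * w x))"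
    proof (rule integral_mono_AE[OF W(3) integrable_mult_right[OF ann_int]])
      show "AE x in lebesgue_on \<Omega>. \<bar>u x\<bar> powr p * w x \<le> (1 / s) * (ann i (Suc j) x * w x)"
        using weight_pos by eventually_elim (metis upper mult.assoc mult_right_mono less_imp_le)
    qed
    also have "\<dots> = (?m (Suc j) - ?m i) / s"
      using ann_mass[of i "Suc j"] ij by simp
    also have "\<dots> \<le> 3"
      using \<open>0 < s\<close> inner outer by (simp add: pos_divide_le_eq s_def)
    finally show ?thesis .
  qed
  have grad: "(LINT x|lebesgue_on \<Omega>. norm (G x) powr p * w x) \<le> 2 * 2 powr p"
  proof -
    have "(LINT x|lebesgue_on \<Omega>. norm (G x) powr p * w x) \<le>
        (LINT x|lebesgue_on \<Omega>. (2 powr p / s) * (ann i (Suc i) x * w x + ann j (Suc j) x * w x))"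
    proof (rule integral_mono_AE[OF W(4)])
      show "AE x in lebesgue_on \<Omega>. norm (G x) powr p * w x
          \<le> (2 powr p / s) * (ann i (Suc i) x * w x + ann j (Suc j) x * w x)"
        using weight_pos
        by eventually_elim (metis gradient mult.assoc mult_right_mono less_imp_le distrib_right)
    qed (use ann_int in auto)
    also have "\<dots> = (2 powr p / s) * ((?m (Suc i) - ?m i) + (?m (Suc j) - ?m j))"
      using ann_int ann_mass[of i "Suc i"] ann_mass[of j "Suc j"] by simp
    also have "\<dots> \<le> (2 powr p / s) * (2 * s)"
      using \<open>0 < s\<close> inner outer by (intro mult_left_mono) (auto simp: s_def)
    also have "\<dots> = 2 * 2 powr p"
      using \<open>0 < s\<close> by simp
    finally show ?thesis .
  qed
  have "0 \<le> (LINT x|lebesgue_on \<Omega>. norm (G x) powr p * w x)"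
    by (rule integral_nonneg_AE) (use weight_pos in \<open>eventually_elim, simp\<close>)
  then have "\<bar>weighted_W1p_norm \<Omega> p w u\<bar> \<le> (3 + 2 * 2 powr p) powr (1 / p)"
    using W(2) p one three grad by (auto intro!: powr_mono2)
  then show ?thesis
    using that W(1) p one supp by auto
qed

end

theorem theorem3p3:
  fixes \<Omega> :: "(real ^ 'n) set" and w :: "real ^ 'n \<Rightarrow> real" and p :: real
  assumes "open \<Omega>" and "1 \<le> p"
    and "weight_on \<Omega> w" and "weight_condition \<Omega> p w"
    and "\<exists>C. AE x in lebesgue_on \<Omega>. \<bar>w x\<bar> \<le> C"
    and "compact_embedding (weighted_W1p \<Omega> p w) (weighted_W1p_norm \<Omega> p w)
           (weighted_Lp \<Omega> p w) (weighted_Lp_norm \<Omega> p w)"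
  shows "(\<integral>\<^sup>+x. ennreal (w x) \<partial>lebesgue_on \<Omega>) < \<infinity>"
proof (rule ccontr)
  assume "\<not> ?thesis"
  then have not_int: "\<not> integrable (lebesgue_on \<Omega>) w"
    using integrable_imp_nn_integral_finite by blast
  obtain C0 where "AE x in lebesgue_on \<Omega>. \<bar>w x\<bar> \<le> C0"
    using assms(5) by blast
  then have C: "AE x in lebesgue_on \<Omega>. \<bar>w x\<bar> \<le> \<bar>C0\<bar>"
    by eventually_elim simp
  note mass = ball_mass_nonneg[OF assms(1,3) C] ball_mass_unbounded[OF assms(1,3) C not_int]
    ball_mass_growth[OF assms(1,3) C abs_ge_zero]
  have "\<exists>u J. u \<in> weighted_W1p \<Omega> p w \<and> \<bar>weighted_W1p_norm \<Omega> p w u\<bar> \<le> (3 + 2 * 2 powr p) powr (1 / p) \<and>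
      1 \<le> (LINT x|lebesgue_on \<Omega>. \<bar>u x\<bar> powr p * w x) \<and>
      (\<forall>x. u x \<noteq> 0 \<longrightarrow> real i < smooth_norm x \<and> smooth_norm x < real J)" for i
  proof -
    obtain j where "i < j" "0 < ball_mass \<Omega> w j - ball_mass \<Omega> w (Suc i)"
      "ball_mass \<Omega> w (Suc i) - ball_mass \<Omega> w i \<le> ball_mass \<Omega> w j - ball_mass \<Omega> w (Suc i)"
      "ball_mass \<Omega> w (Suc j) - ball_mass \<Omega> w j \<le> ball_mass \<Omega> w j - ball_mass \<Omega> w (Suc i)"
      using light_boundary_layers[OF mass, of i] by blast
    then show ?thesis
    proof (rule normalized_annular_function[OF assms(1,3) C assms(2)], goal_cases)
      case (1 u)
      then show ?case
        by (intro exI[of _ u] exI[of _ "Suc j"] conjI allI impI) simp_all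
    qed
  qed
  then have "\<forall>i. \<exists>u J. u \<in> weighted_W1p \<Omega> p w \<and> \<bar>weighted_W1p_norm \<Omega> p w u\<bar> \<le> (3 + 2 * 2 powr p) powr (1 / p) \<and>
      1 \<le> (LINT x|lebesgue_on \<Omega>. \<bar>u x\<bar> powr p * w x) \<and>
      (\<forall>x. u x \<noteq> 0 \<longrightarrow> real i < smooth_norm x \<and> smooth_norm x < real J)"
    by (rule allI)
  then obtain u J where u: "\<forall>i. u i \<in> weighted_W1p \<Omega> p w \<and>
      \<bar>weighted_W1p_norm \<Omega> p w (u i)\<bar> \<le> (3 + 2 * 2 powr p) powr (1 / p) \<and>
      1 \<le> (LINT x|lebesgue_on \<Omega>. \<bar>u i x\<bar> powr p * w x) \<and>
      (\<forall>x. u i x \<noteq> 0 \<longrightarrow> real i < smooth_norm x \<and> smooth_norm x < real (J i))"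
    unfolding choice_iff by (elim exE)
  show False
    by (rule escaping_functions_contradict_compactness[OF assms(3) _ assms(6),
          where u = u and J = J and \<rho> = smooth_norm and B = "(3 + 2 * 2 powr p) powr (1 / p)"])
      (use u assms(2) in simp_all)
qed

end
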